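(* Let $\mathcal{H}$ be a complex Hilbert space, let $A,B,C,D,S,T\in\mathcal{B}(\mathcal{H})$, let $q\in[0,1]$ and let $\alpha\in[0,1]$. Then $$\begin{aligned}\omega_q(ATB+CSD)\le{}& \frac q2\left\|B^*|T|^{2\alpha}B+A|T^*|^{2(1-\alpha)}A^*+D^*|S|^{2\alpha}D+C|S^*|^{2(1-\alpha)}C^*\right\|\\ &+\left(\sqrt{1-q^2}+\sqrt{2q\sqrt{1-q^2}}\right)\Big(\sqrt{\|B^*|T|^{2\alpha}B\|\,\|A|T^*|^{2(1-\alpha)}A^*\|}\\ &\qquad+\sqrt{\|D^*|S|^{2\alpha}D\|\,\|C|S^*|^{2(1-\alpha)}C^*\|}\Big).\end{aligned}$$
   Context: $\mathcal{B}(\mathcal{H})$ denotes the bounded linear operators on the complex Hilbert space $\mathcal{H}$, $\|\cdot\|$ the operator norm, $T^*$ the adjoint of $T$, and $|T|=(T^*T)^{1/2}$ the absolute value of $T$. Nonnegative powers of positive operators are taken by functional calculus, with zeroth power equal to the identity. For $q\in[0,1]$, the $q$-numerical radius of $T$ is $\omega_q(T)=\sup\{|\langle Tx,y\rangle| : x,y\in\mathcal{H},\ \|x\|=\|y\|=1,\ \langle x,y\rangle=q\}$. The supremum over the empty set (which occurs only when $\dim\mathcal{H}=0$, or $\dim\mathcal{H}=1$ and $q<1$) is read as $0$. *)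

theory Defs
  imports "HOL-Analysis.Analysis" "HOL-Computational_Algebra.Polynomial"
begin

class complex_vector = real_vector +
  fixes scaleC :: "complex \<Rightarrow> 'a \<Rightarrow> 'a"  (infixr "*\<^sub>C" 75)
  assumes scaleC_add_right: "c *\<^sub>C (x + y) = c *\<^sub>C x + c *\<^sub>C y"
    and scaleC_add_left: "(b + c) *\<^sub>C x = b *\<^sub>C x + c *\<^sub>C x"
    and scaleC_scaleC: "b *\<^sub>C (c *\<^sub>C x) = (b * c) *\<^sub>C x"
    and scaleC_one: "1 *\<^sub>C x = x"
    and scaleR_scaleC: "r *\<^sub>R x = complex_of_real r *\<^sub>C x"

text \<open>The inner product is linear in its first argument and conjugate-linear in its second.\<close>

class complex_inner = complex_vector + real_normed_vector +
  fixes cinner :: "'a \<Rightarrow> 'a \<Rightarrow> complex"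
  assumes cinner_commute: "cinner x y = cnj (cinner y x)"
    and cinner_add_left: "cinner (x + y) z = cinner x z + cinner y z"
    and cinner_scaleC_left: "cinner (c *\<^sub>C x) y = c * cinner x y"
    and cinner_ge_zero: "0 \<le> Re (cinner x x)"
    and cinner_eq_zero_iff: "cinner x x = 0 \<longleftrightarrow> x = 0"
    and norm_eq_sqrt_cinner: "norm x = sqrt (Re (cinner x x))"

class chilbert_space = complex_inner + complete_space

text \<open>A bounded operator on a complex Hilbert space is an element of the library type
  of bounded real-linear maps that is moreover complex-linear. The norm of that type is
  the operator norm.\<close>

definition clinear_op :: "('a::complex_inner \<Rightarrow>\<^sub>L 'a) \<Rightarrow> bool" where
  "clinear_op T \<longleftrightarrow> (\<forall>c x. T (c *\<^sub>C x) = c *\<^sub>C T x)"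

definition adj :: "('a::complex_inner \<Rightarrow>\<^sub>L 'a) \<Rightarrow> ('a \<Rightarrow>\<^sub>L 'a)" where
  "adj T = (THE S::'a \<Rightarrow>\<^sub>L 'a. \<forall>x y. cinner (T x) y = cinner x (S y))"

definition spectrum :: "('a::complex_inner \<Rightarrow>\<^sub>L 'a) \<Rightarrow> complex set" where
  "spectrum T = {l. \<not> (\<exists>R::'a \<Rightarrow>\<^sub>L 'a. \<forall>x. R (l *\<^sub>C x - T x) = x \<and> l *\<^sub>C R x - T (R x) = x)}"

definition poly_op :: "real poly \<Rightarrow> ('a::real_normed_vector \<Rightarrow>\<^sub>L 'a) \<Rightarrow> ('a \<Rightarrow>\<^sub>L 'a)" where
  "poly_op p T = (\<Sum>i\<le>degree p. coeff p i *\<^sub>R (((o\<^sub>L) T ^^ i) id_blinfun))"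

text \<open>Continuous functional calculus of a self-adjoint operator \<open>P\<close>: the operator \<open>f(P)\<close>
  is the norm limit of \<open>p\<^sub>n(P)\<close> for every sequence of polynomials \<open>p\<^sub>n\<close> converging to
  \<open>f\<close> uniformly on the spectrum. The spectrum of such a \<open>P\<close> is real, so only its real
  points have to be considered and real polynomials suffice for real-valued \<open>f\<close>.\<close>

definition fun_calc :: "(real \<Rightarrow> real) \<Rightarrow> ('a::complex_inner \<Rightarrow>\<^sub>L 'a) \<Rightarrow> ('a \<Rightarrow>\<^sub>L 'a)" where
  "fun_calc f P = (THE X. \<forall>p::nat \<Rightarrow> real poly.
     uniform_limit {t. complex_of_real t \<in> spectrum P} (\<lambda>n. poly (p n)) f sequentially
       \<longrightarrow> (\<lambda>n. poly_op (p n) P) \<longlonglongrightarrow> X)"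

text \<open>Powers of positive operators with exponent \<open>r \<ge> 0\<close>. The case distinction makes the
  zeroth power the identity, since \<open>0 powr 0 = 0\<close> in the library.\<close>

definition op_powr :: "('a::complex_inner \<Rightarrow>\<^sub>L 'a) \<Rightarrow> real \<Rightarrow> ('a \<Rightarrow>\<^sub>L 'a)" where
  "op_powr P r = fun_calc (\<lambda>t. if r = 0 then 1 else t powr r) P"

definition abs_op :: "('a::complex_inner \<Rightarrow>\<^sub>L 'a) \<Rightarrow> ('a \<Rightarrow>\<^sub>L 'a)" where
  "abs_op T = op_powr (adj T o\<^sub>L T) (1/2)"

text \<open>The supremum over the empty set is read as \<open>0\<close>.\<close>

definition q_numerical_radius :: "real \<Rightarrow> ('a::complex_inner \<Rightarrow>\<^sub>L 'a) \<Rightarrow> real" where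
  "q_numerical_radius q T =
     (let W = {cmod (cinner (T x) y) | x y.
                 norm x = 1 \<and> norm y = 1 \<and> cinner x y = complex_of_real q}
      in if W = {} then 0 else Sup W)"

end

theory Submission
  imports Defs "HOL-Computational_Algebra.Fundamental_Theorem_Algebra"
begin

text \<open>
  For unit vectors with \<open>\<langle>x, y\<rangle> = q\<close> put \<open>P = B* |T|^(2\<alpha>) B\<close>, \<open>Q = A |T*|^(2(1 - \<alpha>)) A*\<close> and
  \<open>s = sqrt (1 - q\<^sup>2)\<close>. The mixed Schwarz inequality (\<open>mixed_schwarz_op_powr\<close>), applied to \<open>B x\<close>
  and \<open>A* y\<close>, gives \<open>\<bar>\<langle>A T B x, y\<rangle>\<bar>\<^sup>2 \<le> \<langle>P x, x\<rangle> \<langle>Q y, y\<rangle>\<close>. Since \<open>y = q x + w\<close> with \<open>\<parallel>w\<parallel> = s\<close>,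
  expanding the form of \<open>Q\<close> gives \<open>\<langle>Q y, y\<rangle> \<le> q\<^sup>2 \<langle>Q x, x\<rangle> + 2 q s \<parallel>Q\<parallel> + s\<^sup>2 \<parallel>Q\<parallel>\<close>. Multiply by
  \<open>\<langle>P x, x\<rangle> \<le> \<parallel>P\<parallel>\<close>, take the root of the three summands separately, and use
  \<open>q sqrt (\<langle>P x, x\<rangle> \<langle>Q x, x\<rangle>) \<le> q / 2 (\<langle>P x, x\<rangle> + \<langle>Q x, x\<rangle>)\<close> on the first one
  (\<open>product_form_bound\<close>). The forms at \<open>x\<close> of the two products \<open>A T B\<close> and \<open>C S D\<close> add up to one
  form at \<open>x\<close>, which is at most the norm of the sum of the four operators.

  The mixed Schwarz inequality rests on the functional calculus of a positive operator. That
  calculus is well defined because \<open>\<parallel>p(P)\<parallel>\<close> is at most the maximum of \<open>\<bar>p\<bar>\<close> on the spectrum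
  (\<open>norm_poly_op_le\<close>). For this, \<open>p(P)\<^sup>2 - \<parallel>p(P)\<parallel>\<^sup>2\<close> is not bounded below
  (\<open>selfadj_sq_minus_norm_sq_not_bounded_below\<close>); splitting \<open>p\<^sup>2 - \<parallel>p(P)\<parallel>\<^sup>2\<close> into complex linear
  factors, some factor \<open>P - z\<close> is not bounded below, and this \<open>z\<close> is a real point of the spectrum
  with \<open>\<bar>p z\<bar> = \<parallel>p(P)\<parallel>\<close>.

  Two existence statements are needed: adjoints, and inverses of positive definite operators,
  which put the spectrum of a positive \<open>P\<close> inside \<open>[0, \<parallel>P\<parallel>]\<close>. Both follow from one variational
  argument (\<open>symmetric_coercive_form_represents\<close>).
\<close>

section \<open>Complex inner product spaces\<close>

instance chilbert_space \<subseteq> banach ..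

lemma Re_cinner_commute: "Re (cinner x y) = Re (cinner y x)"
  using arg_cong[OF cinner_commute[of x y], of Re] by simp

lemma cinner_add_right: "cinner x (y + z) = cinner x y + cinner x z"
  by (metis cinner_commute cinner_add_left complex_cnj_add)

lemma cinner_scaleC_right: "cinner x (c *\<^sub>C y) = cnj c * cinner x y"
  by (metis cinner_commute cinner_scaleC_left complex_cnj_mult)

lemma cinner_scaleR_left: "cinner (r *\<^sub>R x) y = r *\<^sub>R cinner x y"
  by (simp add: scaleR_scaleC cinner_scaleC_left scaleR_conv_of_real)

lemma cinner_scaleR_right: "cinner x (r *\<^sub>R y) = r *\<^sub>R cinner x y"
  by (simp add: scaleR_scaleC cinner_scaleC_right scaleR_conv_of_real)

lemma cinner_self: "cinner x x = complex_of_real ((norm x)\<^sup>2)"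
proof -
  have "Im (cinner x x) = 0"
    using arg_cong[OF cinner_commute[of x x], of Im] by simp
  then show ?thesis
    by (simp add: complex_eq_iff norm_eq_sqrt_cinner cinner_ge_zero)
qed

lemma norm_add_sq: "(norm (x + y))\<^sup>2 = (norm x)\<^sup>2 + 2 * Re (cinner x y) + (norm y)\<^sup>2"
proof -
  have "complex_of_real ((norm (x + y))\<^sup>2) = cinner (x + y) (x + y)"
    by (simp only: cinner_self)
  also have "\<dots> = cinner x x + (cinner x y + cnj (cinner x y)) + cinner y y"
    using cinner_commute[of y x] by (simp add: cinner_add_left cinner_add_right)
  finally have "Re (complex_of_real ((norm (x + y))\<^sup>2))
      = Re (cinner x x + (cinner x y + cnj (cinner x y)) + cinner y y)"
    by (rule arg_cong)
  then show ?thesis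
    by (simp add: cinner_self)
qed

lemma norm_scaleC: "norm (c *\<^sub>C x) = cmod c * norm (x::'a::complex_inner)"
proof -
  have "complex_of_real ((norm (c *\<^sub>C x))\<^sup>2) = (c * cnj c) * cinner x x"
    unfolding cinner_self[symmetric] by (simp add: cinner_scaleC_left cinner_scaleC_right)
  also have "\<dots> = complex_of_real ((cmod c * norm x)\<^sup>2)"
    by (simp only: cinner_self complex_norm_square[symmetric] of_real_mult power_mult_distrib)
  finally have "(norm (c *\<^sub>C x))\<^sup>2 = (cmod c * norm x)\<^sup>2"
    by (simp only: of_real_eq_iff)
  then show ?thesis
    by (simp add: power2_eq_iff_nonneg)
qed

lemma cauchy_schwarz: "cmod (cinner x y) \<le> norm x * norm y"
proof (cases "y = 0")
  case True
  have "cinner x (0 *\<^sub>R y) = 0"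
    by (simp only: cinner_scaleR_right) simp
  then show ?thesis using True by simp
next
  case False
  define a where "a = (norm y)\<^sup>2"
  have a: "a > 0" using False by (simp add: a_def)
  define c where "c = - cinner x y / complex_of_real a"
  \<comment> \<open>\<^term>\<open>x + c *\<^sub>C y\<close> is the component of \<^term>\<open>x\<close> orthogonal to \<^term>\<open>y\<close>.\<close>
  have "0 \<le> (norm (x + c *\<^sub>C y))\<^sup>2" by simp
  also have "\<dots> = (norm x)\<^sup>2 + 2 * Re (cnj c * cinner x y) + (cmod c)\<^sup>2 * a"
    by (simp only: norm_add_sq cinner_scaleC_right norm_scaleC power_mult_distrib a_def)
  also have "cnj c * cinner x y = - complex_of_real ((cmod (cinner x y))\<^sup>2 / a)"
    unfolding c_def using complex_norm_square[of "cinner x y"] by (simp add: mult.commute)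
  also have "(cmod c)\<^sup>2 * a = (cmod (cinner x y))\<^sup>2 / a"
    using a unfolding c_def
    by (simp add: norm_divide power_divide power2_eq_square)
  finally have "(cmod (cinner x y))\<^sup>2 / a \<le> (norm x)\<^sup>2"
    by simp
  then have "(cmod (cinner x y))\<^sup>2 \<le> (norm x * norm y)\<^sup>2"
    using a by (simp add: field_simps a_def)
  then show ?thesis
    by (rule power2_le_imp_le) simp
qed

lemma bounded_bilinear_cinner: "bounded_bilinear (cinner :: 'a::complex_inner \<Rightarrow> 'a \<Rightarrow> complex)"
proof
  show "\<exists>K. \<forall>x y. norm (cinner (x::'a) y) \<le> norm x * norm y * K"
    by (rule exI[of _ 1]) (simp add: cauchy_schwarz)
qed (simp_all add: cinner_add_left cinner_add_right cinner_scaleR_left cinner_scaleR_right)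

interpretation cinner: bounded_bilinear "cinner :: 'a::complex_inner \<Rightarrow> 'a \<Rightarrow> complex"
  by (rule bounded_bilinear_cinner)

lemma cinner_right_eqI:
  fixes u v :: "'a::complex_inner"
  assumes "\<And>x. cinner x u = cinner x v"
  shows "u = v"
proof -
  have "cinner (u - v) (u - v) = 0"
    using assms by (simp add: cinner.diff_right)
  then show ?thesis by (simp add: cinner_eq_zero_iff)
qed

lemma cinner_left_eqI:
  fixes u v :: "'a::complex_inner"
  assumes "\<And>x. cinner u x = cinner v x"
  shows "u = v"
  by (rule cinner_right_eqI) (metis assms cinner_commute)

section \<open>The variational principle and adjoints\<close>

text \<open>The energy \<open>J x = B x x / 2 - \<phi> x\<close> is bounded below by coercivity, and the parallelogram
  identity \<open>J x / 2 + J y / 2 - J ((x + y) / 2) = B (x - y) (x - y) / 8\<close> makes every minimizing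
  sequence Cauchy. At the minimizer the first variation \<open>B x h - \<phi> h\<close> vanishes. With \<open>B\<close> the real
  part of the inner product this is the Riesz representation theorem, and with \<open>B\<close> the form
  of a positive definite operator it inverts that operator.\<close>

lemma symmetric_coercive_form_represents:
  fixes B :: "'a::banach \<Rightarrow> 'a \<Rightarrow> real" and \<phi> :: "'a \<Rightarrow> real"
  assumes bil: "bounded_bilinear B" and sym: "\<And>x y. B x y = B y x"
    and c: "c > 0" and coer: "\<And>x. c * (norm x)\<^sup>2 \<le> B x x"
    and lin: "bounded_linear \<phi>"
  shows "\<exists>x. \<forall>h. B x h = \<phi> h"
proof -
  interpret B: bounded_bilinear B by (rule bil)
  interpret f: bounded_linear \<phi> by (rule lin)
  define J where "J x = B x x / 2 - \<phi> x" for x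
  obtain K where K: "K \<ge> 0" "\<And>x. \<bar>\<phi> x\<bar> \<le> norm x * K"
    using f.nonneg_bounded by auto
  have lower: "- (K\<^sup>2 / (2 * c)) \<le> J x" for x
  proof -
    have "0 \<le> (c * norm x - K)\<^sup>2 / (2 * c)" using c by simp
    also have "\<dots> = c * (norm x)\<^sup>2 / 2 - norm x * K + K\<^sup>2 / (2 * c)"
      using c by (simp add: power2_eq_square field_simps)
    finally show ?thesis
      using coer[of x] K(2)[of x] unfolding J_def by linarith
  qed
  define m where "m = (INF x. J x)"
  have bdd: "bdd_below (range J)"
    using lower by (intro bdd_belowI2) auto
  have m: "m \<le> J x" for x
    unfolding m_def by (rule cINF_lower[OF bdd]) simp
  have "\<exists>x. J x < m + 1 / real (Suc n)" for n
  proof -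
    have "Inf (range J) < m + 1 / real (Suc n)" by (simp add: m_def)
    then show ?thesis
      using cInf_lessD[of "range J"] by auto
  qed
  then obtain X where X: "\<And>n. J (X n) < m + 1 / real (Suc n)" by metis
  have par: "J x / 2 + J y / 2 - J ((1/2) *\<^sub>R (x + y)) = B (x - y) (x - y) / 8" for x y
    unfolding J_def
    by (simp add: B.scaleR_left B.scaleR_right B.add_left B.add_right B.diff_left B.diff_right
        f.scaleR f.add sym[of y x] field_simps)
  have close: "c * (norm (x - y))\<^sup>2 \<le> 4 * (J x - m) + 4 * (J y - m)" for x y
  proof -
    have "B (x - y) (x - y) = 4 * J x + 4 * J y - 8 * J ((1/2) *\<^sub>R (x + y))"
      using par[of x y] by argo
    then show ?thesis
      using m[of "(1/2) *\<^sub>R (x + y)"] coer[of "x - y"] by argo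
  qed
  have "Cauchy X"
  proof (rule metric_CauchyI)
    fix e :: real assume e: "e > 0"
    obtain N where N: "8 / (c * e\<^sup>2) < real N"
      using reals_Archimedean2 by blast
    have Npos: "real N > 0" 
      using N c e by (meson divide_pos_pos mult_pos_pos order_less_trans zero_less_numeral zero_less_power)
    have arith: "a < 8 * w" if "a \<le> 4 * u + 4 * v" "u < w" "v < w" for a u v w :: real
      using that by linarith
    have "dist (X i) (X j) < e" if ij: "i \<ge> N" "j \<ge> N" for i j
    proof -
      have le: "1 / real (Suc k) \<le> 1 / real N" if "k \<ge> N" for k
        using that Npos by (intro divide_left_mono) auto
      have "c * (norm (X i - X j))\<^sup>2 < 8 * (1 / real N)"
      proof -
        have "J (X i) - m < 1 / real N" "J (X j) - m < 1 / real N"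
          using X[of i] X[of j] le[OF ij(1)] le[OF ij(2)] by linarith+
        with close[of "X i" "X j"] show ?thesis
          by (rule arith)
      qed
      also have "\<dots> \<le> c * e\<^sup>2"
        using N Npos c e by (simp add: field_simps)
      finally have "(norm (X i - X j))\<^sup>2 < e\<^sup>2" using c by simp
      then show ?thesis using e by (simp add: dist_norm power_less_imp_less_base)
    qed
    then show "\<exists>M. \<forall>i\<ge>M. \<forall>j\<ge>M. dist (X i) (X j) < e" by blast
  qed
  then obtain x where x: "X \<longlonglongrightarrow> x"
    using Cauchy_convergent convergent_def by blast
  have "(\<lambda>n. J (X n)) \<longlonglongrightarrow> J x"
    unfolding J_def by (intro tendsto_intros B.tendsto f.tendsto x) simp
  moreover have "(\<lambda>n. m + 1 / real (Suc n)) \<longlonglongrightarrow> m + 0"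
    by (intro tendsto_intros LIMSEQ_Suc[OF lim_1_over_n])
  ultimately have "J x \<le> m + 0"
    using X by (intro LIMSEQ_le[of _ _ _ "m + 0"]) (auto intro: less_imp_le)
  with m have min: "J x \<le> J y" for y by (metis add.right_neutral order_trans)
  have "B x h = \<phi> h" for h
  proof -
    define d where "d = B x h - \<phi> h"
    have var: "0 \<le> t * d + t\<^sup>2 * B h h / 2" for t
    proof -
      have "J (x + t *\<^sub>R h) = J x + (t * d + t\<^sup>2 * B h h / 2)"
        unfolding J_def d_def
        by (simp add: B.scaleR_left B.scaleR_right B.add_left B.add_right f.scaleR f.add
            sym[of h x] power2_eq_square field_simps)
      then show ?thesis using min[of "x + t *\<^sub>R h"] by linarith
    qed
    have Bh: "0 \<le> B h h"
      using coer[of h] c by (meson less_imp_le mult_nonneg_nonneg order_trans zero_le_power2)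
    \<comment> \<open>The step \<open>t\<close> minimizes the parabola, up to the summand 1 that avoids division by 0.\<close>
    define t where "t = - d / (B h h + 1)"
    have "t * d + t\<^sup>2 * B h h / 2 = - (d\<^sup>2 / (B h h + 1)\<^sup>2) * (B h h / 2 + 1)"
      using Bh unfolding t_def by (simp add: power2_eq_square divide_simps) (simp add: algebra_simps)
    then have "d\<^sup>2 / (B h h + 1)\<^sup>2 * (B h h / 2 + 1) \<le> 0"
      using var[of t] by simp
    moreover have "0 < d\<^sup>2 / (B h h + 1)\<^sup>2 * (B h h / 2 + 1)" if "d \<noteq> 0"
      using that Bh by (intro mult_pos_pos divide_pos_pos) auto
    ultimately have "d = 0" by (meson not_less)
    then show ?thesis by (simp add: d_def)
  qed
  then show ?thesis by blast
qed

text \<open>The vector that represents \<open>h \<mapsto> Re \<langle>T h, y\<rangle>\<close> depends linearly on \<open>y\<close>. Complex linearity of \<open>T\<close>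
  recovers the imaginary part of the inner product from the real part.\<close>

lemma adjoint_exists:
  fixes T :: "'a::chilbert_space \<Rightarrow>\<^sub>L 'a"
  assumes T: "clinear_op T"
  shows "\<exists>S::'a \<Rightarrow>\<^sub>L 'a. \<forall>x y. cinner (T x) y = cinner x (S y)"
proof -
  have bil: "bounded_bilinear (\<lambda>x y::'a. Re (cinner x y))"
  proof
    show "\<exists>K. \<forall>x y::'a. norm (Re (cinner x y)) \<le> norm x * norm y * K"
      by (rule exI[of _ 1])
        (metis abs_Re_le_cmod cauchy_schwarz mult.right_neutral order_trans real_norm_def)
  qed (simp_all add: cinner_add_left cinner_add_right cinner_scaleR_left cinner_scaleR_right)
  have "\<exists>v. \<forall>h. cinner (T h) y = cinner h v" for y
  proof -
    have lin: "bounded_linear (\<lambda>h. Re (cinner (T h) y))"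
      by (rule bounded_linear_compose[OF bounded_linear_Re bounded_linear_compose[OF
          cinner.bounded_linear_left blinfun.bounded_linear_right]])
    have "\<exists>v. \<forall>h. Re (cinner v h) = Re (cinner (T h) y)"
      by (rule symmetric_coercive_form_represents[OF bil _ zero_less_one _ lin])
        (simp_all add: cinner_self Re_cinner_commute)
    then obtain v where v: "\<And>h. Re (cinner v h) = Re (cinner (T h) y)" by blast
    have re: "Re (cinner h v) = Re (cinner (T h) y)" for h
      using v[of h] by (simp add: Re_cinner_commute)
    have "cinner (T h) y = cinner h v" for h
      \<comment> \<open>The real parts at \<^term>\<open>\<i> *\<^sub>C h\<close> are minus the imaginary parts at \<^term>\<open>h\<close>.\<close>
      using re[of h] re[of "\<i> *\<^sub>C h"] T
      by (simp add: clinear_op_def cinner_scaleC_left complex_eq_iff)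
    then show ?thesis by blast
  qed
  then obtain S where S: "\<And>y h. cinner (T h) y = cinner h (S y)" by metis
  have "bounded_linear S"
  proof (rule bounded_linear_intro)
    show "S (x + y) = S x + S y" for x y
      by (rule cinner_right_eqI) (simp only: cinner_add_right S[symmetric])
    show "S (r *\<^sub>R x) = r *\<^sub>R S x" for r x
      by (rule cinner_right_eqI) (simp only: cinner_scaleR_right S[symmetric])
    show "norm (S y) \<le> norm y * norm T" for y
    proof (cases "S y = 0")
      case False
      have "(norm (S y))\<^sup>2 = cmod (cinner (T (S y)) y)"
        unfolding S cinner_self by (simp add: norm_power)
      also have "\<dots> \<le> norm (T (S y)) * norm y" by (rule cauchy_schwarz)
      also have "\<dots> \<le> (norm T * norm (S y)) * norm y"
        by (intro mult_right_mono norm_blinfun) simp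
      finally show ?thesis using False by (simp add: power2_eq_square mult_ac)
    qed simp
  qed
  then have "\<forall>x y. cinner (T x) y = cinner x (Blinfun S y)"
    using S by (simp add: bounded_linear_Blinfun_apply)
  then show ?thesis by blast
qed

lemma cinner_adj:
  fixes T :: "'a::chilbert_space \<Rightarrow>\<^sub>L 'a"
  assumes "clinear_op T"
  shows "cinner (T x) y = cinner x (adj T y)"
proof -
  obtain S :: "'a \<Rightarrow>\<^sub>L 'a" where S: "\<forall>x y. cinner (T x) y = cinner x (S y)"
    using adjoint_exists[OF assms] by blast
  have "S' = S" if "\<forall>x y. cinner (T x) y = cinner x (S' y)" for S' :: "'a \<Rightarrow>\<^sub>L 'a"
    using that S by (intro blinfun_eqI cinner_right_eqI) metis
  then have "adj T = S"
    unfolding adj_def using S by (intro the_equality)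
  then show ?thesis using S by simp
qed

lemma cinner_adj_left:
  fixes T :: "'a::chilbert_space \<Rightarrow>\<^sub>L 'a"
  assumes "clinear_op T"
  shows "cinner (adj T x) y = cinner x (T y)"
  by (metis assms cinner_adj cinner_commute)

lemma clinear_op_adj:
  fixes T :: "'a::chilbert_space \<Rightarrow>\<^sub>L 'a"
  assumes "clinear_op T"
  shows "clinear_op (adj T)"
  unfolding clinear_op_def
proof (intro allI)
  fix c x
  show "adj T (c *\<^sub>C x) = c *\<^sub>C adj T x"
    by (rule cinner_right_eqI)
      (simp add: cinner_scaleC_right cinner_adj[OF assms, symmetric])
qed

lemma adj_adj:
  fixes T :: "'a::chilbert_space \<Rightarrow>\<^sub>L 'a"
  assumes "clinear_op T"
  shows "adj (adj T) = T"
  by (intro blinfun_eqI cinner_right_eqI)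
    (simp add: cinner_adj[OF clinear_op_adj[OF assms], symmetric] cinner_adj_left[OF assms])

definition selfadj :: "('a::complex_inner \<Rightarrow>\<^sub>L 'a) \<Rightarrow> bool" where
  "selfadj P \<longleftrightarrow> (\<forall>x y. cinner (P x) y = cinner x (P y))"

definition pos_op :: "('a::complex_inner \<Rightarrow>\<^sub>L 'a) \<Rightarrow> bool" where
  "pos_op P \<longleftrightarrow> selfadj P \<and> (\<forall>x. 0 \<le> Re (cinner (P x) x))"

lemma selfadjD: "selfadj P \<Longrightarrow> cinner (P x) y = cinner x (P y)"
  by (simp add: selfadj_def)

lemma pos_op_selfadj: "pos_op P \<Longrightarrow> selfadj P"
  by (simp add: pos_op_def)

text \<open>Symmetry moves \<open>P\<close> to the other argument, where the scalar can be pulled out of the first.\<close>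

lemma selfadj_clinear: "selfadj P \<Longrightarrow> clinear_op P"
  unfolding clinear_op_def
  by (intro allI cinner_left_eqI) (simp add: selfadjD cinner_scaleC_left)

lemma pos_op_adj_comp:
  fixes T :: "'a::chilbert_space \<Rightarrow>\<^sub>L 'a"
  assumes "clinear_op T"
  shows "pos_op (adj T o\<^sub>L T)"
  unfolding pos_op_def selfadj_def
  by (simp add: cinner_adj[OF assms, symmetric] cinner_adj_left[OF assms] cinner_self)

section \<open>Polynomials of an operator\<close>

interpretation blinfun_compose: bounded_bilinear "(o\<^sub>L)"
  by (rule bounded_bilinear_blinfun_compose)

lemma poly_op_altdef:
  assumes "degree p \<le> n"
  shows "poly_op p T = (\<Sum>i\<le>n. coeff p i *\<^sub>R (((o\<^sub>L) T ^^ i) id_blinfun))"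
  unfolding poly_op_def using assms
  by (intro sum.mono_neutral_left) (auto simp: coeff_eq_0)

lemma poly_op_0 [simp]: "poly_op 0 T = 0"
  by (simp add: poly_op_def)

lemma poly_op_pCons [simp]: "poly_op (pCons a p) T = a *\<^sub>R id_blinfun + (T o\<^sub>L poly_op p T)"
proof -
  have "poly_op (pCons a p) T =
      (\<Sum>i\<le>Suc (degree p). coeff (pCons a p) i *\<^sub>R (((o\<^sub>L) T ^^ i) id_blinfun))"
    by (rule poly_op_altdef) (rule degree_pCons_le)
  also have "\<dots> = a *\<^sub>R id_blinfun + (T o\<^sub>L poly_op p T)"
    by (subst sum.atMost_Suc_shift)
      (simp add: poly_op_def blinfun_compose.sum_right blinfun_compose.scaleR_right)
  finally show ?thesis .
qed

lemma poly_op_add: "poly_op (p + q) T = poly_op p T + poly_op q T"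
proof -
  let ?n = "max (degree p) (degree q)"
  have "poly_op (p + q) T = (\<Sum>i\<le>?n. coeff (p + q) i *\<^sub>R (((o\<^sub>L) T ^^ i) id_blinfun))"
    by (rule poly_op_altdef) (rule degree_add_le_max)
  also have "\<dots> = poly_op p T + poly_op q T"
    by (subst (1 2) poly_op_altdef[of _ ?n]) (simp_all add: scaleR_left_distrib sum.distrib)
  finally show ?thesis .
qed

lemma poly_op_smult: "poly_op (smult c p) T = c *\<^sub>R poly_op p T"
  by (subst poly_op_altdef[of _ "degree p"])
    (simp_all add: poly_op_def scaleR_sum_right degree_smult_le)

lemma poly_op_diff: "poly_op (p - q) T = poly_op p T - poly_op q T"
  using poly_op_add[of p "- q" T] poly_op_smult[of "- 1" q T] by simp

lemma poly_op_mult: "poly_op (p * q) T = poly_op p T o\<^sub>L poly_op q T"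
proof (induct p)
  case (pCons a p)
  then show ?case
    by (intro blinfun_eqI) (simp add: poly_op_add poly_op_smult blinfun.bilinear_simps)
qed simp

lemma poly_op_intertwine:
  assumes "T o\<^sub>L P = P' o\<^sub>L T"
  shows "T o\<^sub>L poly_op p P = poly_op p P' o\<^sub>L T"
proof (induct p)
  case (pCons a p)
  have "T (P x) = P' (T x)" for x
    using arg_cong[OF assms, of "\<lambda>F. blinfun_apply F x"] by simp
  moreover have "T (poly_op p P x) = poly_op p P' (T x)" for x
    using arg_cong[OF pCons(2), of "\<lambda>F. blinfun_apply F x"] by simp
  ultimately show ?case
    by (intro blinfun_eqI) (simp add: blinfun.bilinear_simps)
qed simp

lemma selfadj_poly_op:
  assumes P: "selfadj P"
  shows "selfadj (poly_op p P)"
proof (induct p)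
  case (pCons a p)
  have "poly_op p P (P x) = P (poly_op p P x)" for x
    using arg_cong[OF poly_op_intertwine[of P P P p], of "\<lambda>F. blinfun_apply F x"] by simp
  then show ?case
    using pCons(2) P unfolding selfadj_def
    by (simp add: blinfun.bilinear_simps cinner.add_left cinner.add_right cinner.scaleR_left
        cinner.scaleR_right)
qed (simp add: selfadj_def cinner.zero_left cinner.zero_right)

text \<open>Complex polynomials serve only to split a real polynomial into linear factors, so it suffices
  to evaluate them at a vector. The recursion is Horner's scheme.\<close>

definition cpoly_at :: "complex poly \<Rightarrow> ('a::complex_inner \<Rightarrow>\<^sub>L 'a) \<Rightarrow> 'a \<Rightarrow> 'a" where
  "cpoly_at p P x = fold_coeffs (\<lambda>a v. a *\<^sub>C x + P v) p 0"

lemma scaleC_zero_left [simp]: "0 *\<^sub>C x = (0 :: 'a::complex_inner)"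
  by (metis of_real_0 scaleR_scaleC scaleR_zero_left)

lemma scaleC_minus_left: "(- c) *\<^sub>C x = - (c *\<^sub>C (x::'a::complex_inner))"
  using scaleC_add_left[of "- c" c x] by (simp add: eq_neg_iff_add_eq_0)

lemma cpoly_at_0 [simp]: "cpoly_at 0 P x = 0"
  by (simp add: cpoly_at_def)

lemma cpoly_at_pCons [simp]: "cpoly_at (pCons a p) P x = a *\<^sub>C x + P (cpoly_at p P x)"
  by (cases "p = 0 \<and> a = 0") (auto simp: cpoly_at_def blinfun.zero_right)

lemma cpoly_at_add: "cpoly_at (p + q) P x = cpoly_at p P x + cpoly_at q P x"
  by (induct p q rule: poly_induct2) (simp_all add: blinfun.add_right scaleC_add_left)

lemma cpoly_at_smult:
  assumes "clinear_op P"
  shows "cpoly_at (smult c p) P x = c *\<^sub>C cpoly_at p P x"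
proof (induct p)
  case 0
  have "c *\<^sub>C (0::'a) = 0" by (metis scaleC_scaleC mult_zero_right scaleC_zero_left)
  then show ?case by simp
next
  case (pCons a p)
  have "P (c *\<^sub>C v) = c *\<^sub>C P v" for v
    using assms by (simp add: clinear_op_def)
  with pCons show ?case by (simp add: scaleC_add_right scaleC_scaleC)
qed

lemma cpoly_at_of_real: "cpoly_at (map_poly complex_of_real p) P x = poly_op p P x"
  by (induct p) (simp_all add: map_poly_pCons scaleR_scaleC[symmetric] blinfun.bilinear_simps)

text \<open>Over the complex numbers \<open>p\<close> is a product of linear factors, and a composition of maps that
  are bounded below is bounded below.\<close>

lemma cpoly_at_bounded_below:
  fixes P :: "'a::complex_inner \<Rightarrow>\<^sub>L 'a"
  assumes P: "clinear_op P" and "p \<noteq> 0"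
    and "\<And>z. poly p z = 0 \<Longrightarrow> \<exists>c>0. \<forall>x. c * norm x \<le> norm (P x - z *\<^sub>C x)"
  shows "\<exists>c>0. \<forall>x. c * norm x \<le> norm (cpoly_at p P x)"
  using assms(2,3)
proof (induct "degree p" arbitrary: p rule: less_induct)
  case less
  show ?case
  proof (cases "degree p = 0")
    case True
    then obtain a where p: "p = [:a:]" by (rule degree_eq_zeroE)
    with less.prems(1) have "cmod a > 0" by simp
    moreover have "cmod a * norm x \<le> norm (cpoly_at p P x)" for x
      by (simp add: p norm_scaleC blinfun.zero_right)
    ultimately show ?thesis by blast
  next
    case False
    then obtain z where z: "poly p z = 0"
      using fundamental_theorem_of_algebra[of p] constant_degree[of p] by auto
    then obtain q where q: "p = [:- z, 1:] * q"
      unfolding poly_eq_0_iff_dvd by (rule dvdE)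
    with less.prems(1) have "q \<noteq> 0" by auto
    then have "degree p = Suc (degree q)"
      unfolding q by (subst degree_mult_eq) auto
    then obtain c where c: "c > 0" "\<And>x. c * norm x \<le> norm (cpoly_at q P x)"
      using less.hyps[of q] \<open>q \<noteq> 0\<close> less.prems(2) unfolding q by auto
    obtain d where d: "d > 0" "\<And>x. d * norm x \<le> norm (P x - z *\<^sub>C x)"
      using less.prems(2)[OF z] by auto
    have "d * c * norm x \<le> norm (cpoly_at p P x)" for x
    proof -
      let ?v = "cpoly_at q P x"
      have "p = pCons 0 q + smult (- z) q" unfolding q by simp
      then have "cpoly_at p P x = P ?v - z *\<^sub>C ?v"
        by (simp only: cpoly_at_add cpoly_at_smult[OF P] cpoly_at_pCons scaleC_minus_left
            scaleC_zero_left) simp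
      moreover have "d * c * norm x \<le> d * norm ?v"
        using c(2)[of x] d(1) by (simp add: mult.assoc)
      ultimately show ?thesis using d(2)[of ?v] by simp
    qed
    moreover have "d * c > 0" using c d by simp
    ultimately show ?thesis by blast
  qed
qed

section \<open>Spectra of self-adjoint operators\<close>

lemma scaleC_of_real: "complex_of_real r *\<^sub>C x = r *\<^sub>R x"
  by (simp add: scaleR_scaleC)

lemma selfadj_bounded_below_off_reals:
  fixes P :: "'a::complex_inner \<Rightarrow>\<^sub>L 'a"
  assumes P: "selfadj P"
  shows "\<bar>Im z\<bar> * norm x \<le> norm (P x - z *\<^sub>C x)"
proof (cases "x = 0")
  case False
  have "cinner (P x) x = cnj (cinner (P x) x)"
    using selfadjD[OF P, of x x] cinner_commute[of x "P x"] by simp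
  then have "Im (cinner (P x) x) = 0"
    by (metis Reals_cnj_iff complex_is_Real_iff)
  then have "Im (cinner (P x - z *\<^sub>C x) x) = - Im z * (norm x)\<^sup>2"
    by (simp add: cinner.diff_left cinner_scaleC_left cinner_self)
  then have "\<bar>Im z\<bar> * (norm x)\<^sup>2 = \<bar>Im (cinner (P x - z *\<^sub>C x) x)\<bar>"
    by (simp add: abs_mult)
  also have "\<dots> \<le> norm (P x - z *\<^sub>C x) * norm x"
    by (rule order_trans[OF abs_Im_le_cmod cauchy_schwarz])
  finally show ?thesis using False by (simp add: power2_eq_square)
qed simp

lemma bounded_below_off_spectrum:
  assumes "z \<notin> spectrum P"
  shows "\<exists>c>0. \<forall>x. c * norm x \<le> norm (P x - z *\<^sub>C x)"
proof -
  obtain R :: "'a \<Rightarrow>\<^sub>L 'a" where R: "\<And>x. R (z *\<^sub>C x - P x) = x"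
    using assms unfolding spectrum_def by blast
  have pos: "norm R + 1 > 0" by (smt (verit) norm_ge_zero)
  have "1 / (norm R + 1) * norm x \<le> norm (P x - z *\<^sub>C x)" for x
  proof -
    have "norm x \<le> norm R * norm (z *\<^sub>C x - P x)"
      using norm_blinfun[of R "z *\<^sub>C x - P x"] by (simp add: R)
    also have "\<dots> \<le> (norm R + 1) * norm (P x - z *\<^sub>C x)"
      by (simp add: norm_minus_commute mult_right_mono)
    finally show ?thesis using pos by (simp add: field_simps)
  qed
  with pos show ?thesis by (intro exI[of _ "1 / (norm R + 1)"]) auto
qed

text \<open>If \<open>Q\<^sup>2 - \<parallel>Q\<parallel>\<^sup>2\<close> were bounded below by \<open>c\<close>, expanding its square at \<open>x\<close> would give
  \<open>\<parallel>Q x\<parallel>\<^sup>2 \<le> (\<parallel>Q\<parallel>\<^sup>2 - c\<^sup>2 / \<parallel>Q\<parallel>\<^sup>2) \<parallel>x\<parallel>\<^sup>2\<close>, which contradicts the definition of the norm.\<close>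

lemma selfadj_sq_minus_norm_sq_not_bounded_below:
  fixes Q :: "'a::complex_inner \<Rightarrow>\<^sub>L 'a"
  assumes Q: "selfadj Q" and nz: "(u::'a) \<noteq> 0"
  shows "\<not> (\<exists>c>0. \<forall>x. c * norm x \<le> norm (Q (Q x) - (norm Q)\<^sup>2 *\<^sub>R x))"
proof
  define N where "N = norm Q"
  assume "\<exists>c>0. \<forall>x. c * norm x \<le> norm (Q (Q x) - (norm Q)\<^sup>2 *\<^sub>R x)"
  then obtain c where c: "c > 0" "\<And>x. c * norm x \<le> norm (Q (Q x) - N\<^sup>2 *\<^sub>R x)"
    unfolding N_def by blast
  show False
  proof (cases "N = 0")
    case True
    then have "Q = 0" by (simp add: N_def)
    then show False using c(1) c(2)[of u] nz True by (simp add: mult_le_0_iff)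
  next
    case False
    then have N: "N > 0" by (simp add: N_def)
    define M where "M = N\<^sup>2 - c\<^sup>2 / N\<^sup>2"
    have M: "(norm (Q x))\<^sup>2 \<le> M * (norm x)\<^sup>2" for x
    proof -
      have "c\<^sup>2 * (norm x)\<^sup>2 \<le> (norm (Q (Q x) + (- N\<^sup>2) *\<^sub>R x))\<^sup>2"
        using power_mono[OF c(2)[of x], of 2] c(1) by (simp add: power_mult_distrib)
      also have "\<dots> = (norm (Q (Q x)))\<^sup>2 - 2 * N\<^sup>2 * (norm (Q x))\<^sup>2 + N\<^sup>2 * N\<^sup>2 * (norm x)\<^sup>2"
        unfolding norm_add_sq
        by (simp add: cinner_scaleR_right cinner.minus_right selfadjD[OF Q, of "Q x" x] cinner_self
            power_mult_distrib power2_eq_square)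
      also have "(norm (Q (Q x)))\<^sup>2 \<le> N\<^sup>2 * (norm (Q x))\<^sup>2"
        using power_mono[OF norm_blinfun[of Q "Q x"], of 2] by (simp add: N_def power_mult_distrib)
      finally have "N\<^sup>2 * (norm (Q x))\<^sup>2 \<le> N\<^sup>2 * N\<^sup>2 * (norm x)\<^sup>2 - c\<^sup>2 * (norm x)\<^sup>2"
        by simp
      then show ?thesis using N by (simp add: M_def field_simps power2_eq_square)
    qed
    have "norm (Q x) \<le> sqrt (max 0 M) * norm x" for x
    proof (rule power2_le_imp_le)
      have "(norm (Q x))\<^sup>2 \<le> max 0 M * (norm x)\<^sup>2"
        by (rule order_trans[OF M]) (intro mult_right_mono, auto)
      then show "(norm (Q x))\<^sup>2 \<le> (sqrt (max 0 M) * norm x)\<^sup>2"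
        by (simp add: power_mult_distrib)
    qed simp
    then have "N \<le> sqrt (max 0 M)"
      unfolding N_def by (intro norm_blinfun_bound) auto
    then have "N\<^sup>2 \<le> (sqrt (max 0 M))\<^sup>2"
      using N by (intro power_mono) auto
    then have "N\<^sup>2 \<le> max 0 M" by simp
    moreover have "M < N\<^sup>2" using c(1) N by (simp add: M_def)
    ultimately show False using N by (simp add: max_def split: if_splits)
  qed
qed

text \<open>A root \<open>z\<close> of \<open>p\<^sup>2 - \<parallel>p(P)\<parallel>\<^sup>2\<close> for which \<open>P - z\<close> is not bounded below must be real and in the
  spectrum. The polynomial must be nonzero for such a root to be produced; it vanishes exactly
  when \<open>p\<close> is one of the constants \<open>\<plusminus>\<parallel>p(P)\<parallel>\<close>.\<close>

lemma norm_poly_op_attained_on_spectrum: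
  fixes P :: "'a::complex_inner \<Rightarrow>\<^sub>L 'a"
  assumes P: "selfadj P" and nz: "(u::'a) \<noteq> 0"
    and nonconst: "p * p \<noteq> [:(norm (poly_op p P))\<^sup>2:]"
  shows "\<exists>t. complex_of_real t \<in> spectrum P \<and> \<bar>poly p t\<bar> = norm (poly_op p P)"
proof -
  define N where "N = norm (poly_op p P)"
  define r where "r = p * p - [:N\<^sup>2:]"
  have r: "poly_op r P x = poly_op p P (poly_op p P x) - N\<^sup>2 *\<^sub>R x" for x
    by (simp add: r_def poly_op_diff poly_op_mult blinfun.bilinear_simps)
  have "map_poly complex_of_real r \<noteq> 0"
    using nonconst by (simp add: r_def N_def map_poly_eq_0_iff)
  moreover have "\<not> (\<exists>c>0. \<forall>x. c * norm x \<le> norm (cpoly_at (map_poly complex_of_real r) P x))"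
    using selfadj_sq_minus_norm_sq_not_bounded_below[OF selfadj_poly_op[OF P, of p] nz]
    by (simp add: cpoly_at_of_real r N_def)
  ultimately obtain z where z: "poly (map_poly complex_of_real r) z = 0"
      "\<not> (\<exists>c>0. \<forall>x. c * norm x \<le> norm (P x - z *\<^sub>C x))"
    using cpoly_at_bounded_below[OF selfadj_clinear[OF P]] by blast
  have "Im z = 0"
    using z(2) selfadj_bounded_below_off_reals[OF P, of z] by (meson zero_less_abs_iff)
  then have t: "z = complex_of_real (Re z)" by (simp add: complex_eq_iff)
  have "poly (map_poly complex_of_real r) (complex_of_real s) = complex_of_real (poly r s)" for s
    by (induct r) (simp_all add: map_poly_pCons)
  with z(1) have "poly r (Re z) = 0" by (metis t of_real_eq_0_iff)
  then have "(poly p (Re z))\<^sup>2 = N\<^sup>2"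
    by (simp add: r_def power2_eq_square)
  then have "\<bar>poly p (Re z)\<bar> = N"
    by (metis N_def abs_norm_cancel power2_eq_iff abs_minus_cancel)
  moreover have "z \<in> spectrum P"
    using z(2) bounded_below_off_spectrum by blast
  ultimately show ?thesis using t N_def by metis
qed

lemma norm_poly_op_le:
  fixes P :: "'a::complex_inner \<Rightarrow>\<^sub>L 'a"
  assumes P: "selfadj P" and e: "0 \<le> e"
    and le: "\<And>t. complex_of_real t \<in> spectrum P \<Longrightarrow> \<bar>poly p t\<bar> \<le> e"
  shows "norm (poly_op p P) \<le> e"
proof (cases "\<exists>u::'a. u \<noteq> 0")
  case False
  then have "x = 0" for x :: 'a by blast
  then have "norm (poly_op p P x) \<le> e * norm x" for x
    using e by (metis norm_ge_zero mult_nonneg_nonneg norm_zero)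
  then show ?thesis using e by (intro norm_blinfun_bound)
next
  case True
  then obtain u :: 'a where u: "u \<noteq> 0" by blast
  show ?thesis
  proof (cases "degree p = 0")
    case False
    then have "degree (p * p) \<noteq> 0" by (subst degree_mult_eq) auto
    then have "p * p \<noteq> [:(norm (poly_op p P))\<^sup>2:]" by (metis degree_pCons_0)
    then obtain t where "complex_of_real t \<in> spectrum P" "\<bar>poly p t\<bar> = norm (poly_op p P)"
      using norm_poly_op_attained_on_spectrum[OF P u] by blast
    with le show ?thesis by metis
  next
    case deg: True
    then obtain a where p: "p = [:a:]" by (rule degree_eq_zeroE)
    \<comment> \<open>A constant polynomial is controlled by the spectrum only because the spectrum is nonempty.\<close>
    obtain t where "complex_of_real t \<in> spectrum P"
      using norm_poly_op_attained_on_spectrum[OF P u, of "[:0, 1:]"] by auto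
    from le[OF this] have "\<bar>a\<bar> \<le> e" by (simp add: p)
    moreover have "norm (poly_op p P) \<le> \<bar>a\<bar>"
      by (simp add: p mult_left_le norm_blinfun_id_le)
    ultimately show ?thesis by simp
  qed
qed

text \<open>The form \<open>Re \<langle>Q x, y\<rangle>\<close> is symmetric and coercive, so it represents every functional
  \<open>Re \<langle>y, -\<rangle>\<close>: this is surjectivity. Coercivity also bounds \<open>Q\<close> below, hence bounds the inverse.\<close>

lemma positive_definite_invertible:
  fixes Q :: "'a::chilbert_space \<Rightarrow>\<^sub>L 'a"
  assumes Q: "selfadj Q" and c: "c > 0" and coer: "\<And>x. c * (norm x)\<^sup>2 \<le> Re (cinner (Q x) x)"
  shows "\<exists>R::'a \<Rightarrow>\<^sub>L 'a. \<forall>x. R (Q x) = x \<and> Q (R x) = x"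
proof -
  have below: "c * norm x \<le> norm (Q x)" for x
  proof (cases "x = 0")
    case False
    have "c * (norm x)\<^sup>2 \<le> norm (Q x) * norm x"
      using coer[of x] cauchy_schwarz[of "Q x" x] complex_Re_le_cmod[of "cinner (Q x) x"] by linarith
    then show ?thesis using False by (simp add: power2_eq_square)
  qed simp
  have bil: "bounded_bilinear (\<lambda>x y. Re (cinner (Q x) y))"
  proof
    have "\<bar>Re (cinner (Q x) y)\<bar> \<le> norm x * norm y * norm Q" for x y
    proof -
      have "\<bar>Re (cinner (Q x) y)\<bar> \<le> norm (Q x) * norm y"
        by (rule order_trans[OF abs_Re_le_cmod cauchy_schwarz])
      also have "\<dots> \<le> (norm Q * norm x) * norm y"
        by (intro mult_right_mono norm_blinfun) simp
      finally show ?thesis by (simp add: mult_ac)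
    qed
    then show "\<exists>K. \<forall>x y. norm (Re (cinner (Q x) y)) \<le> norm x * norm y * K" by auto
  qed (simp_all add: blinfun.bilinear_simps cinner_add_left cinner_add_right cinner_scaleR_left
      cinner_scaleR_right)
  have sym: "Re (cinner (Q x) y) = Re (cinner (Q y) x)" for x y
    by (simp add: selfadjD[OF Q, of x y] Re_cinner_commute)
  have "\<exists>x. Q x = y" for y
  proof -
    have "bounded_linear (\<lambda>h. Re (cinner y h))"
      by (rule bounded_linear_compose[OF bounded_linear_Re cinner.bounded_linear_right])
    from symmetric_coercive_form_represents[OF bil sym c coer this]
    obtain x where "\<And>h. Re (cinner (Q x) h) = Re (cinner y h)" by blast
    then have "Re (cinner (Q x - y) (Q x - y)) = 0" by (simp add: cinner.diff_left)
    then have "Q x = y" by (simp add: cinner_self)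
    then show ?thesis by blast
  qed
  then obtain R where R: "\<And>y. Q (R y) = y" by metis
  have inj: "x = y" if "Q x = Q y" for x y
    using below[of "x - y"] that c by (simp add: blinfun.diff_right mult_le_0_iff)
  have "bounded_linear R"
  proof (rule bounded_linear_intro)
    show "R (x + y) = R x + R y" for x y by (rule inj) (simp add: R blinfun.add_right)
    show "R (r *\<^sub>R x) = r *\<^sub>R R x" for r x by (rule inj) (simp add: R blinfun.scaleR_right)
    show "norm (R x) \<le> norm x * (1 / c)" for x
      using below[of "R x"] c by (simp add: R field_simps)
  qed
  then have "\<forall>x. Blinfun R (Q x) = x \<and> Q (Blinfun R x) = x"
    by (auto simp: bounded_linear_Blinfun_apply R intro: inj)
  then show ?thesis by blast
qed

text \<open>For \<open>t < 0\<close> the operator \<open>P - t\<close> is positive definite, and for \<open>t > \<parallel>P\<parallel>\<close> the operator \<open>t - P\<close>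
  is. The sign \<open>s\<close> treats both cases at once.\<close>

lemma pos_op_spectrum:
  fixes P :: "'a::chilbert_space \<Rightarrow>\<^sub>L 'a"
  assumes P: "pos_op P" and t: "complex_of_real t \<in> spectrum P"
  shows "t \<in> {0..norm P}"
proof (rule ccontr)
  assume "t \<notin> {0..norm P}"
  then consider "t < 0" | "t > norm P" by fastforce
  then obtain s c :: real where s: "s \<noteq> 0" and c: "c > 0"
    and coer: "\<And>x. c * (norm x)\<^sup>2 \<le> Re (cinner (s *\<^sub>R (P x - t *\<^sub>R x)) x)"
  proof cases
    case 1
    have "(- t) * (norm x)\<^sup>2 \<le> Re (cinner (1 *\<^sub>R (P x - t *\<^sub>R x)) x)" for x
      using P by (simp add: pos_op_def cinner.diff_left cinner_scaleR_left cinner_self)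
    with 1 show ?thesis by (intro that[of 1 "- t"]) auto
  next
    case 2
    have "(t - norm P) * (norm x)\<^sup>2 \<le> Re (cinner ((- 1) *\<^sub>R (P x - t *\<^sub>R x)) x)" for x
    proof -
      have "Re (cinner (P x) x) \<le> norm (P x) * norm x"
        by (rule order_trans[OF complex_Re_le_cmod cauchy_schwarz])
      also have "\<dots> \<le> norm P * norm x * norm x"
        by (intro mult_right_mono norm_blinfun) simp
      finally show ?thesis
        by (simp add: cinner.diff_left cinner_scaleR_left cinner_self algebra_simps
            power2_eq_square)
    qed
    with 2 show ?thesis by (intro that[of "- 1" "t - norm P"]) auto
  qed
  define Q where "Q = s *\<^sub>R (P - t *\<^sub>R id_blinfun)"
  have Qx: "Q x = s *\<^sub>R (P x - t *\<^sub>R x)" for x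
    by (simp add: Q_def blinfun.bilinear_simps)
  have "selfadj Q"
    using pos_op_selfadj[OF P] unfolding selfadj_def Qx
    by (simp add: cinner.diff_left cinner.diff_right cinner_scaleR_left cinner_scaleR_right)
  from positive_definite_invertible[OF this c coer[folded Qx]]
  obtain R :: "'a \<Rightarrow>\<^sub>L 'a" where R: "\<And>x. R (Q x) = x" "\<And>x. Q (R x) = x" by blast
  have "((- s) *\<^sub>R R) (complex_of_real t *\<^sub>C x - P x) = x" for x
    using R(1)[of x] by (simp add: Qx scaleC_of_real blinfun.bilinear_simps scaleR_diff_right mult.commute)
  moreover have "complex_of_real t *\<^sub>C ((- s) *\<^sub>R R) x - P (((- s) *\<^sub>R R) x) = x" for x
    using R(2)[of x] by (simp add: Qx scaleC_of_real blinfun.bilinear_simps algebra_simps)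
  ultimately show False
    using t unfolding spectrum_def by blast
qed

section \<open>The functional calculus of a positive operator\<close>

lemma Weierstrass_poly_approximation:
  fixes f :: "real \<Rightarrow> real"
  assumes "continuous_on {0..} f"
  shows "\<exists>p. uniform_limit {0..M} (\<lambda>n. poly (p n)) f sequentially"
proof -
  have "continuous_on {0..M} f"
    by (rule continuous_on_subset[OF assms]) auto
  then obtain g where g: "uniform_limit {0..M} g f sequentially" "\<And>n::nat. polynomial_function (g n)"
    using Stone_Weierstrass_uniform_limit[of "{0..M}" f] by (metis compact_Icc)
  have "\<exists>q. g n = poly q" for n
  proof -
    obtain a k where "g n = (\<lambda>x. \<Sum>i\<le>k. a i * x ^ i)"
      using g(2)[of n] unfolding real_polynomial_function_eq[symmetric]
        real_polynomial_function_iff_sum by blast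
    then have "g n = poly (\<Sum>i\<le>k. monom (a i) i)"
      by (simp add: fun_eq_iff poly_sum poly_monom)
    then show ?thesis by blast
  qed
  then obtain p where "\<And>n. g n = poly (p n)" by metis
  then have "g = (\<lambda>n. poly (p n))" by (simp add: fun_eq_iff)
  with g(1) show ?thesis by auto
qed

text \<open>The bound of \<open>\<parallel>p(P)\<parallel>\<close> by the maximum of \<open>\<bar>p\<bar>\<close> on the spectrum turns uniform Cauchy
  sequences of polynomials into Cauchy sequences of operators and makes the limit independent of
  the approximating sequence.\<close>

lemma fun_calc_limit_on_spectrum:
  fixes P :: "'a::chilbert_space \<Rightarrow>\<^sub>L 'a"
  assumes P: "pos_op P" and f: "continuous_on {0..} f"
    and lim: "uniform_limit {t. complex_of_real t \<in> spectrum P} (\<lambda>n. poly (p n)) f sequentially"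
  shows "(\<lambda>n. poly_op (p n) P) \<longlonglongrightarrow> fun_calc f P"
proof -
  define S where "S = {t. complex_of_real t \<in> spectrum P}"
  have close: "norm (poly_op (a - b) P) \<le> d + e"
    if "\<forall>t\<in>S. dist (poly a t) (f t) < d" "\<forall>t\<in>S. dist (poly b t) (f t) < e" "d > 0" "e > 0"
    for a b d e
  proof (rule norm_poly_op_le[OF pos_op_selfadj[OF P]])
    fix t assume "complex_of_real t \<in> spectrum P"
    then have "t \<in> S" by (simp add: S_def)
    with that(1,2) have "\<bar>poly a t - f t\<bar> < d" "\<bar>poly b t - f t\<bar> < e"
      by (auto simp: dist_real_def)
    then show "\<bar>poly (a - b) t\<bar> \<le> d + e" by simp
  qed (use that in simp)
  obtain p0 where "uniform_limit {0..norm P} (\<lambda>n. poly (p0 n)) f sequentially"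
    using Weierstrass_poly_approximation[OF f] by blast
  then have p0: "uniform_limit S (\<lambda>n. poly (p0 n)) f sequentially"
    by (rule uniform_limit_on_subset) (use pos_op_spectrum[OF P] in \<open>auto simp: S_def\<close>)
  have ev: "\<exists>N. \<forall>n\<ge>N. \<forall>t\<in>S. dist (poly (q n) t) (f t) < e"
    if "uniform_limit S (\<lambda>n. poly (q n)) f sequentially" "e > 0" for q e
    using that by (simp add: uniform_limit_sequentially_iff)
  have "Cauchy (\<lambda>n. poly_op (p0 n) P)"
  proof (rule metric_CauchyI)
    fix e :: real assume "e > 0"
    then obtain N where "\<forall>n\<ge>N. \<forall>t\<in>S. dist (poly (p0 n) t) (f t) < e / 3"
      using ev[OF p0, of "e / 3"] by auto
    then have "norm (poly_op (p0 i - p0 j) P) \<le> e / 3 + e / 3" if "i \<ge> N" "j \<ge> N" for i j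
      using that \<open>e > 0\<close> by (intro close) auto
    then have "dist (poly_op (p0 i) P) (poly_op (p0 j) P) < e" if "i \<ge> N" "j \<ge> N" for i j
      using that \<open>e > 0\<close> by (fastforce simp: dist_norm poly_op_diff)
    then show "\<exists>M. \<forall>m\<ge>M. \<forall>n\<ge>M. dist (poly_op (p0 m) P) (poly_op (p0 n) P) < e" by blast
  qed
  then obtain X where X: "(\<lambda>n. poly_op (p0 n) P) \<longlonglongrightarrow> X"
    using Cauchy_convergent convergent_def by blast
  have all: "(\<lambda>n. poly_op (q n) P) \<longlonglongrightarrow> X"
    if q: "uniform_limit S (\<lambda>n. poly (q n)) f sequentially" for q
  proof -
    have "(\<lambda>n. poly_op (q n) P - poly_op (p0 n) P) \<longlonglongrightarrow> 0"
    proof (rule LIMSEQ_I)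
      fix e :: real assume "e > 0"
      then obtain N1 N2 where "\<forall>n\<ge>N1. \<forall>t\<in>S. dist (poly (q n) t) (f t) < e / 3"
        "\<forall>n\<ge>N2. \<forall>t\<in>S. dist (poly (p0 n) t) (f t) < e / 3"
        using ev[OF p0, of "e / 3"] ev[OF q, of "e / 3"] by auto
      then have "norm (poly_op (q n - p0 n) P) \<le> e / 3 + e / 3" if "n \<ge> max N1 N2" for n
        using that \<open>e > 0\<close> by (intro close) auto
      then have "norm (poly_op (q n) P - poly_op (p0 n) P - 0) < e" if "n \<ge> max N1 N2" for n
        using that \<open>e > 0\<close> by (fastforce simp: poly_op_diff)
      then show "\<exists>no. \<forall>n\<ge>no. norm (poly_op (q n) P - poly_op (p0 n) P - 0) < e" by blast
    qed
    from tendsto_add[OF this X] show ?thesis by simp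
  qed
  have "fun_calc f P = X"
    unfolding fun_calc_def S_def[symmetric]
  proof (rule the_equality)
    show "\<forall>p. uniform_limit S (\<lambda>n. poly (p n)) f sequentially \<longrightarrow> (\<lambda>n. poly_op (p n) P) \<longlonglongrightarrow> X"
      using all by blast
    show "Y = X"
      if "\<forall>p. uniform_limit S (\<lambda>n. poly (p n)) f sequentially \<longrightarrow> (\<lambda>n. poly_op (p n) P) \<longlonglongrightarrow> Y" for Y
      using that p0 X LIMSEQ_unique by blast
  qed
  with all lim show ?thesis by (simp add: S_def)
qed

lemma fun_calc_limit:
  fixes P :: "'a::chilbert_space \<Rightarrow>\<^sub>L 'a"
  assumes P: "pos_op P" and f: "continuous_on {0..} f" and M: "norm P \<le> M"
    and lim: "uniform_limit {0..M} (\<lambda>n. poly (p n)) f sequentially"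
  shows "(\<lambda>n. poly_op (p n) P) \<longlonglongrightarrow> fun_calc f P"
proof (rule fun_calc_limit_on_spectrum[OF P f])
  show "uniform_limit {t. complex_of_real t \<in> spectrum P} (\<lambda>n. poly (p n)) f sequentially"
    by (rule uniform_limit_on_subset[OF lim]) (use pos_op_spectrum[OF P] M in fastforce)
qed

lemma fun_calc_poly:
  fixes P :: "'a::chilbert_space \<Rightarrow>\<^sub>L 'a"
  assumes P: "pos_op P" and eq: "\<And>t. t \<ge> 0 \<Longrightarrow> f t = poly p t"
  shows "fun_calc f P = poly_op p P"
proof -
  have "continuous_on {0..} f \<longleftrightarrow> continuous_on {0..} (poly p)"
    by (rule continuous_on_cong) (auto simp: eq)
  then have "continuous_on {0..} f" by (simp add: continuous_on_poly)
  moreover have "uniform_limit {0..norm P} (\<lambda>n. poly p) f sequentially"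
    by (rule uniform_limitI) (auto simp: eq)
  ultimately have "(\<lambda>n. poly_op p P) \<longlonglongrightarrow> fun_calc f P"
    using fun_calc_limit[OF P _ order_refl, of f "\<lambda>n. p"] by simp
  then show ?thesis by (simp add: LIMSEQ_const_iff)
qed

lemma fun_calc_add:
  fixes P :: "'a::chilbert_space \<Rightarrow>\<^sub>L 'a"
  assumes P: "pos_op P" and f: "continuous_on {0..} f" and g: "continuous_on {0..} g"
  shows "fun_calc (\<lambda>t. f t + g t) P = fun_calc f P + fun_calc g P"
proof -
  obtain p q where p: "uniform_limit {0..norm P} (\<lambda>n. poly (p n)) f sequentially"
    and q: "uniform_limit {0..norm P} (\<lambda>n. poly (q n)) g sequentially"
    using Weierstrass_poly_approximation[OF f] Weierstrass_poly_approximation[OF g] by blast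
  have "uniform_limit {0..norm P} (\<lambda>n. poly (p n + q n)) (\<lambda>t. f t + g t) sequentially"
  proof -
    have "poly (a + b) = (\<lambda>t. poly a t + poly b t)" for a b :: "real poly"
      by (simp add: fun_eq_iff)
    with uniform_limit_add[OF p q] show ?thesis by (simp only:)
  qed
  then have "(\<lambda>n. poly_op (p n + q n) P) \<longlonglongrightarrow> fun_calc (\<lambda>t. f t + g t) P"
    by (intro fun_calc_limit[OF P _ order_refl] continuous_intros f g)
  moreover have "(\<lambda>n. poly_op (p n + q n) P) \<longlonglongrightarrow> fun_calc f P + fun_calc g P"
    unfolding poly_op_add
    by (intro tendsto_add fun_calc_limit[OF P _ order_refl] f g p q)
  ultimately show ?thesis by (rule LIMSEQ_unique)
qed

lemma fun_calc_mult:
  fixes P :: "'a::chilbert_space \<Rightarrow>\<^sub>L 'a"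
  assumes P: "pos_op P" and f: "continuous_on {0..} f" and g: "continuous_on {0..} g"
  shows "fun_calc (\<lambda>t. f t * g t) P = fun_calc f P o\<^sub>L fun_calc g P"
proof -
  obtain p q where p: "uniform_limit {0..norm P} (\<lambda>n. poly (p n)) f sequentially"
    and q: "uniform_limit {0..norm P} (\<lambda>n. poly (q n)) g sequentially"
    using Weierstrass_poly_approximation[OF f] Weierstrass_poly_approximation[OF g] by blast
  have bdd: "bounded (h ` {0..norm P})" if "continuous_on {0..} h" for h :: "real \<Rightarrow> real"
    by (intro compact_imp_bounded compact_continuous_image continuous_on_subset[OF that]) auto
  have "uniform_limit {0..norm P} (\<lambda>n. poly (p n * q n)) (\<lambda>t. f t * g t) sequentially"
  proof -
    have "poly (a * b) = (\<lambda>t. poly a t * poly b t)" for a b :: "real poly"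
      by (simp add: fun_eq_iff)
    with uniform_lim_mult[OF p q bdd[OF f] bdd[OF g]] show ?thesis by (simp only:)
  qed
  then have "(\<lambda>n. poly_op (p n * q n) P) \<longlonglongrightarrow> fun_calc (\<lambda>t. f t * g t) P"
    by (intro fun_calc_limit[OF P _ order_refl] continuous_intros f g)
  moreover have "(\<lambda>n. poly_op (p n * q n) P) \<longlonglongrightarrow> (fun_calc f P o\<^sub>L fun_calc g P)"
    unfolding poly_op_mult
    by (intro blinfun_compose.tendsto fun_calc_limit[OF P _ order_refl] f g p q)
  ultimately show ?thesis by (rule LIMSEQ_unique)
qed

lemma selfadj_fun_calc:
  fixes P :: "'a::chilbert_space \<Rightarrow>\<^sub>L 'a"
  assumes P: "pos_op P" and f: "continuous_on {0..} f"
  shows "selfadj (fun_calc f P)"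
  unfolding selfadj_def
proof (intro allI)
  fix x y
  obtain p where p: "uniform_limit {0..norm P} (\<lambda>n. poly (p n)) f sequentially"
    using Weierstrass_poly_approximation[OF f] by blast
  note lim = fun_calc_limit[OF P f order_refl p]
  have "(\<lambda>n. cinner (poly_op (p n) P x) y) \<longlonglongrightarrow> cinner (fun_calc f P x) y"
    by (intro cinner.tendsto blinfun.tendsto lim tendsto_const)
  moreover have "(\<lambda>n. cinner x (poly_op (p n) P y)) \<longlonglongrightarrow> cinner x (fun_calc f P y)"
    by (intro cinner.tendsto blinfun.tendsto lim tendsto_const)
  ultimately show "cinner (fun_calc f P x) y = cinner x (fun_calc f P y)"
    using selfadjD[OF selfadj_poly_op[OF pos_op_selfadj[OF P]]] LIMSEQ_unique by simp
qed

text \<open>One sequence of polynomials serves both operators if it converges on an interval that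
  contains both spectra.\<close>

lemma fun_calc_intertwine:
  fixes P P' T :: "'a::chilbert_space \<Rightarrow>\<^sub>L 'a"
  assumes P: "pos_op P" and P': "pos_op P'" and f: "continuous_on {0..} f"
    and T: "T o\<^sub>L P = P' o\<^sub>L T"
  shows "T o\<^sub>L fun_calc f P = fun_calc f P' o\<^sub>L T"
proof -
  define M where "M = max (norm P) (norm P')"
  obtain p where p: "uniform_limit {0..M} (\<lambda>n. poly (p n)) f sequentially"
    using Weierstrass_poly_approximation[OF f] by blast
  have "(\<lambda>n. T o\<^sub>L poly_op (p n) P) \<longlonglongrightarrow> (T o\<^sub>L fun_calc f P)"
    by (intro blinfun_compose.tendsto tendsto_const fun_calc_limit[OF P f _ p]) (simp add: M_def)
  moreover have "(\<lambda>n. poly_op (p n) P' o\<^sub>L T) \<longlonglongrightarrow> (fun_calc f P' o\<^sub>L T)"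
    by (intro blinfun_compose.tendsto tendsto_const fun_calc_limit[OF P' f _ p]) (simp add: M_def)
  ultimately show ?thesis
    using poly_op_intertwine[OF T] LIMSEQ_unique by simp
qed

lemma norm_sq_fun_calc:
  fixes P :: "'a::chilbert_space \<Rightarrow>\<^sub>L 'a"
  assumes P: "pos_op P" and f: "continuous_on {0..} f"
  shows "(norm (fun_calc f P x))\<^sup>2 = Re (cinner (fun_calc (\<lambda>t. f t * f t) P x) x)"
  using selfadjD[OF selfadj_fun_calc[OF P f], of "fun_calc f P x" x]
  by (simp add: fun_calc_mult[OF P f f] cinner_self)

lemma fun_calc_cong:
  fixes P :: "'a::chilbert_space \<Rightarrow>\<^sub>L 'a"
  assumes P: "pos_op P" and f: "continuous_on {0..} f" and g: "continuous_on {0..} g"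
    and eq: "\<And>t. t \<ge> 0 \<Longrightarrow> f t = g t"
  shows "fun_calc f P = fun_calc g P"
proof -
  have "fun_calc (\<lambda>t. f t - g t) P = 0"
    by (subst fun_calc_poly[OF P, of _ 0]) (simp_all add: eq)
  then show ?thesis
    using fun_calc_add[OF P g continuous_on_diff[OF f g]] by simp
qed

text \<open>A nonnegative \<open>f\<close> is the square of the continuous function \<open>sqrt \<circ> f\<close>, so \<open>\<langle>f(P) x, x\<rangle>\<close> is the
  squared norm of \<open>sqrt(f)(P) x\<close>.\<close>

lemma pos_op_fun_calc:
  fixes P :: "'a::chilbert_space \<Rightarrow>\<^sub>L 'a"
  assumes P: "pos_op P" and f: "continuous_on {0..} f" and nonneg: "\<And>t. t \<ge> 0 \<Longrightarrow> 0 \<le> f t"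
  shows "pos_op (fun_calc f P)"
proof -
  have c: "continuous_on {0..} (\<lambda>t. sqrt (f t))" by (intro continuous_intros f)
  have "fun_calc (\<lambda>t. sqrt (f t) * sqrt (f t)) P = fun_calc f P"
    by (rule fun_calc_cong[OF P]) (auto intro!: continuous_intros f simp: nonneg)
  then have "0 \<le> Re (cinner (fun_calc f P x) x)" for x
    using norm_sq_fun_calc[OF P c, of x] by (metis zero_le_power2)
  then show ?thesis
    by (simp add: pos_op_def selfadj_fun_calc[OF P f])
qed

lemma fun_calc_mono:
  fixes P :: "'a::chilbert_space \<Rightarrow>\<^sub>L 'a"
  assumes P: "pos_op P" and f: "continuous_on {0..} f" and g: "continuous_on {0..} g"
    and le: "\<And>t. t \<ge> 0 \<Longrightarrow> f t \<le> g t"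
  shows "Re (cinner (fun_calc f P x) x) \<le> Re (cinner (fun_calc g P x) x)"
proof -
  have "fun_calc g P = fun_calc f P + fun_calc (\<lambda>t. g t - f t) P"
    using fun_calc_add[OF P f continuous_on_diff[OF g f]] by simp
  moreover have "pos_op (fun_calc (\<lambda>t. g t - f t) P)"
    by (rule pos_op_fun_calc[OF P continuous_on_diff[OF g f]]) (simp add: le)
  ultimately show ?thesis
    by (simp add: pos_op_def blinfun.add_left cinner_add_left)
qed

section \<open>Powers and the mixed Schwarz inequality\<close>

text \<open>The case \<open>r = 0\<close> is the constant 1, so the value at 0 causes no jump; for \<open>r > 0\<close> the convention
  \<open>0 powr r = 0\<close> is the continuous one.\<close>

lemma continuous_on_op_powr_function:
  fixes r :: real
  assumes "0 \<le> r"
  shows "continuous_on {0..} (\<lambda>t. if r = 0 then 1 else t powr r)"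
proof (cases "r = 0")
  case False
  with assms have "continuous_on {0..} (\<lambda>t. t powr r)"
    by (intro continuous_on_powr') (auto intro!: continuous_intros)
  with False show ?thesis by simp
qed simp

lemma pos_op_op_powr:
  fixes P :: "'a::chilbert_space \<Rightarrow>\<^sub>L 'a"
  assumes "pos_op P" and "0 \<le> r"
  shows "pos_op (op_powr P r)"
  unfolding op_powr_def
  by (rule pos_op_fun_calc[OF assms(1) continuous_on_op_powr_function[OF assms(2)]]) simp

lemma pos_op_abs_op:
  fixes T :: "'a::chilbert_space \<Rightarrow>\<^sub>L 'a"
  assumes "clinear_op T"
  shows "pos_op (abs_op T)"
  unfolding abs_op_def by (rule pos_op_op_powr[OF pos_op_adj_comp[OF assms]]) simp

lemma abs_op_sq:
  fixes T :: "'a::chilbert_space \<Rightarrow>\<^sub>L 'a"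
  assumes "clinear_op T"
  shows "abs_op T o\<^sub>L abs_op T = adj T o\<^sub>L T"
proof -
  note P = pos_op_adj_comp[OF assms]
  have c: "continuous_on {0..} (\<lambda>t::real. if (1/2::real) = 0 then 1 else t powr (1/2))"
    by (rule continuous_on_op_powr_function) simp
  have "abs_op T o\<^sub>L abs_op T = poly_op [:0, 1:] (adj T o\<^sub>L T)"
    unfolding abs_op_def op_powr_def fun_calc_mult[OF P c c, symmetric]
    by (rule fun_calc_poly[OF P]) (simp add: powr_half_sqrt)
  also have "\<dots> = adj T o\<^sub>L T" by (intro blinfun_eqI) (simp add: blinfun.bilinear_simps)
  finally show ?thesis .
qed

text \<open>The polynomial identity \<open>T (T* T) = (T T*) T\<close> passes to the square roots.\<close>

lemma abs_op_intertwine: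
  fixes T :: "'a::chilbert_space \<Rightarrow>\<^sub>L 'a"
  assumes T: "clinear_op T"
  shows "T o\<^sub>L abs_op T = abs_op (adj T) o\<^sub>L T"
  unfolding abs_op_def op_powr_def
proof (rule fun_calc_intertwine[OF pos_op_adj_comp[OF T] pos_op_adj_comp[OF clinear_op_adj[OF T]]])
  show "continuous_on {0..} (\<lambda>t::real. if (1/2::real) = 0 then 1 else t powr (1/2))"
    by (rule continuous_on_op_powr_function) simp
  show "T o\<^sub>L (adj T o\<^sub>L T) = (adj (adj T) o\<^sub>L adj T) o\<^sub>L T"
    by (intro blinfun_eqI) (simp add: adj_adj[OF T])
qed

text \<open>For \<open>d > 0\<close> the function \<open>h = sqrt (f + d)\<close> is positive, so with \<open>k = 1 / h\<close> one has
  \<open>\<langle>T x, y\<rangle> = \<langle>h(|T|) x, k(|T|) T* y\<rangle>\<close>. The first vector has squared norm \<open>\<langle>f(|T|) x, x\<rangle> + d \<parallel>x\<parallel>\<^sup>2\<close>. Moving \<open>T\<close> through the calculus turns the squared norm of the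
  second into \<open>\<langle>u(|T*|) y, y\<rangle>\<close> with \<open>u t = t\<^sup>2 / (f t + d) \<le> g t\<close>. Finally \<open>d\<close> tends to 0.\<close>

lemma mixed_schwarz:
  fixes T :: "'a::chilbert_space \<Rightarrow>\<^sub>L 'a"
  assumes T: "clinear_op T"
    and f: "continuous_on {0..} f" "\<And>t. t \<ge> 0 \<Longrightarrow> 0 \<le> f t"
    and g: "continuous_on {0..} g" "\<And>t. t \<ge> 0 \<Longrightarrow> 0 \<le> g t"
    and fg: "\<And>t. t \<ge> 0 \<Longrightarrow> t\<^sup>2 \<le> f t * g t"
  shows "(cmod (cinner (T x) y))\<^sup>2
    \<le> Re (cinner (fun_calc f (abs_op T) x) x) * Re (cinner (fun_calc g (abs_op (adj T)) y) y)"
proof -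
  define R where "R = abs_op T"
  define L where "L = abs_op (adj T)"
  have R: "pos_op R" unfolding R_def by (rule pos_op_abs_op[OF T])
  have L: "pos_op L" unfolding L_def by (rule pos_op_abs_op[OF clinear_op_adj[OF T]])
  have TR: "T o\<^sub>L R = L o\<^sub>L T" unfolding R_def L_def by (rule abs_op_intertwine[OF T])
  have LL: "L (L v) = T (adj T v)" for v
    using arg_cong[OF abs_op_sq[OF clinear_op_adj[OF T]], of "\<lambda>F. blinfun_apply F v"]
    by (simp add: L_def adj_adj[OF T])
  define F where "F = Re (cinner (fun_calc f R x) x)"
  define G where "G = Re (cinner (fun_calc g L y) y)"
  have G: "G \<ge> 0"
    using pos_op_fun_calc[OF L g] by (simp add: G_def pos_op_def)
  have bound: "(cmod (cinner (T x) y))\<^sup>2 \<le> (F + d * (norm x)\<^sup>2) * G" if d: "d > 0" for d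
  proof -
    have fd: "f t + d > 0" if "t \<ge> 0" for t using f(2)[OF that] d by simp
    define h where "h t = sqrt (f t + d)" for t
    define k where "k t = 1 / sqrt (f t + d)" for t
    have hc: "continuous_on {0..} h"
      unfolding h_def by (intro continuous_intros f(1))
    have kc: "continuous_on {0..} k"
      unfolding k_def using fd by (intro continuous_intros f(1)) (fastforce simp: less_imp_neq)+
    have kh: "k t * h t = 1" and hh: "h t * h t = f t + d" if "t \<ge> 0" for t
      using fd[OF that] by (simp_all add: h_def k_def)
    have sp: "continuous_on {0..} (\<lambda>t::real. t * t)" by (intro continuous_intros)
    have kk: "continuous_on {0..} (\<lambda>t. k t * k t)" by (intro continuous_intros kc)
    have one: "fun_calc k R (fun_calc h R x) = x"
    proof -
      have "fun_calc (\<lambda>t. k t * h t) R = poly_op [:1:] R"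
        by (rule fun_calc_poly[OF R]) (simp add: kh)
      then have "fun_calc k R o\<^sub>L fun_calc h R = id_blinfun"
        by (simp add: fun_calc_mult[OF R kc hc])
      from arg_cong[OF this, of "\<lambda>F. blinfun_apply F x"] show ?thesis by simp
    qed
    have "cinner (T x) y = cinner x (adj T y)" by (rule cinner_adj[OF T])
    also have "\<dots> = cinner (fun_calc k R (fun_calc h R x)) (adj T y)" by (simp only: one)
    also have "\<dots> = cinner (fun_calc h R x) (fun_calc k R (adj T y))"
      by (rule selfadjD[OF selfadj_fun_calc[OF R kc]])
    finally have split: "(cmod (cinner (T x) y))\<^sup>2
        \<le> (norm (fun_calc h R x))\<^sup>2 * (norm (fun_calc k R (adj T y)))\<^sup>2"
      using power_mono[OF cauchy_schwarz[of "fun_calc h R x" "fun_calc k R (adj T y)"], of 2]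
      by (simp add: power_mult_distrib)
    have "fun_calc (\<lambda>t. h t * h t) R = fun_calc f R + fun_calc (\<lambda>t. d) R"
      by (subst fun_calc_add[OF R f(1) continuous_on_const, symmetric])
        (auto intro!: fun_calc_cong[OF R] continuous_intros hc f(1) simp: hh)
    moreover have "fun_calc (\<lambda>t. d) R = poly_op [:d:] R"
      by (rule fun_calc_poly[OF R]) simp
    ultimately have first: "(norm (fun_calc h R x))\<^sup>2 = F + d * (norm x)\<^sup>2"
      by (simp add: norm_sq_fun_calc[OF R hc] F_def blinfun.bilinear_simps cinner_add_left
          cinner_scaleR_left cinner_self)
    have "(norm (fun_calc k R (adj T y)))\<^sup>2
        = Re (cinner (fun_calc (\<lambda>t. k t * k t) R (adj T y)) (adj T y))"
      by (rule norm_sq_fun_calc[OF R kc])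
    also have "\<dots> = Re (cinner (T (fun_calc (\<lambda>t. k t * k t) R (adj T y))) y)"
      by (simp only: cinner_adj[OF T])
    also have "T (fun_calc (\<lambda>t. k t * k t) R (adj T y)) = fun_calc (\<lambda>t. k t * k t) L (T (adj T y))"
      using arg_cong[OF fun_calc_intertwine[OF R L kk TR], of "\<lambda>F. blinfun_apply F (adj T y)"] by simp
    also have "\<dots> = fun_calc (\<lambda>t. k t * k t * (t * t)) L y"
    proof -
      have "fun_calc (\<lambda>t. t * t) L = poly_op [:0, 0, 1:] L"
        by (rule fun_calc_poly[OF L]) simp
      then have "fun_calc (\<lambda>t. t * t) L y = T (adj T y)"
        by (simp add: blinfun.bilinear_simps LL)
      then show ?thesis by (simp add: fun_calc_mult[OF L kk sp])
    qed
    also have "Re (cinner (fun_calc (\<lambda>t. k t * k t * (t * t)) L y) y) \<le> G"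
      unfolding G_def
    proof (rule fun_calc_mono[OF L _ g(1)])
      show "continuous_on {0..} (\<lambda>t. k t * k t * (t * t))" by (intro continuous_intros kc)
      fix t :: real assume t: "t \<ge> 0"
      have "k t * k t * (t * t) = t\<^sup>2 / (f t + d)"
        using fd[OF t] by (simp add: k_def power2_eq_square)
      also have "\<dots> \<le> g t"
      proof -
        have "0 \<le> d * g t" using g(2)[OF t] d by simp
        then have "t\<^sup>2 \<le> g t * (f t + d)"
          using fg[OF t] by (simp add: algebra_simps)
        then show ?thesis using fd[OF t] by (simp add: pos_divide_le_eq)
      qed
      finally show "k t * k t * (t * t) \<le> g t" .
    qed
    finally have "(norm (fun_calc k R (adj T y)))\<^sup>2 \<le> G" .
    from order_trans[OF split mult_left_mono[OF this zero_le_power2]] show ?thesis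
      by (simp only: first)
  qed
  have "((\<lambda>d. (F + d * (norm x)\<^sup>2) * G) \<longlongrightarrow> (F + 0 * (norm x)\<^sup>2) * G) (at_right 0)"
    by (intro tendsto_intros)
  then have "(cmod (cinner (T x) y))\<^sup>2 \<le> (F + 0 * (norm x)\<^sup>2) * G"
    by (rule tendsto_lowerbound)
      (auto simp: eventually_at_right_field intro!: exI[of _ 1] bound)
  then show ?thesis by (simp add: F_def G_def R_def L_def)
qed

lemma mixed_schwarz_op_powr:
  fixes T :: "'a::chilbert_space \<Rightarrow>\<^sub>L 'a"
  assumes T: "clinear_op T" and a: "0 \<le> a" "a \<le> 1"
  shows "(cmod (cinner (T x) y))\<^sup>2
    \<le> Re (cinner (op_powr (abs_op T) (2 * a) x) x)
      * Re (cinner (op_powr (abs_op (adj T)) (2 * (1 - a)) y) y)"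
  unfolding op_powr_def
proof (rule mixed_schwarz[OF T])
  fix t :: real assume t: "t \<ge> 0"
  show "t\<^sup>2 \<le> (if 2 * a = 0 then 1 else t powr (2 * a))
      * (if 2 * (1 - a) = 0 then 1 else t powr (2 * (1 - a)))"
  proof (cases "t = 0")
    case False
    with t have "t > 0" by simp
    have "2 * a + 2 * (1 - a) = 2" by simp
    then have "t\<^sup>2 = t powr (2 * a + 2 * (1 - a))"
      using \<open>t > 0\<close> by (simp only: powr_numeral)
    then have eq: "t\<^sup>2 = t powr (2 * a) * t powr (2 * (1 - a))"
      by (simp only: powr_add)
    show ?thesis
    proof (cases "a = 0 \<or> a = 1")
      case True
      then show ?thesis using \<open>t > 0\<close> by (auto simp: powr_numeral)
    next
      case False
      then have "2 * a \<noteq> 0" "2 * (1 - a) \<noteq> 0" by auto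
      then show ?thesis by (simp only: eq if_False order_refl)
    qed
  qed simp
next
  show "continuous_on {0..} (\<lambda>t. if 2 * a = 0 then 1 else t powr (2 * a))"
    using a by (intro continuous_on_op_powr_function) simp
  show "continuous_on {0..} (\<lambda>t. if 2 * (1 - a) = 0 then 1 else t powr (2 * (1 - a)))"
    using a by (intro continuous_on_op_powr_function) simp
qed simp_all

section \<open>Bounding the q-numerical radius\<close>

lemma quadratic_form_le_norm:
  fixes Q :: "'a::complex_inner \<Rightarrow>\<^sub>L 'a"
  shows "Re (cinner (Q x) y) \<le> norm Q * norm x * norm y"
proof -
  have "Re (cinner (Q x) y) \<le> norm (Q x) * norm y"
    by (rule order_trans[OF complex_Re_le_cmod cauchy_schwarz])
  also have "\<dots> \<le> norm Q * norm x * norm y"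
    by (intro mult_right_mono norm_blinfun) simp
  finally show ?thesis .
qed

lemma pos_op_conjugate:
  fixes B Q :: "'a::chilbert_space \<Rightarrow>\<^sub>L 'a"
  assumes "clinear_op B" and "pos_op Q"
  shows "pos_op (adj B o\<^sub>L Q o\<^sub>L B)"
  unfolding pos_op_def selfadj_def
proof (intro conjI allI)
  fix x y
  show "cinner ((adj B o\<^sub>L Q o\<^sub>L B) x) y = cinner x ((adj B o\<^sub>L Q o\<^sub>L B) y)"
    by (simp add: cinner_adj[OF assms(1), symmetric] cinner_adj_left[OF assms(1)]
        selfadjD[OF pos_op_selfadj[OF assms(2)]])
  show "0 \<le> Re (cinner ((adj B o\<^sub>L Q o\<^sub>L B) x) x)"
    using assms(2) by (simp add: cinner_adj_left[OF assms(1)] pos_op_def)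
qed

lemma pos_op_conjugate_adj:
  fixes A Q :: "'a::chilbert_space \<Rightarrow>\<^sub>L 'a"
  assumes "clinear_op A" and "pos_op Q"
  shows "pos_op (A o\<^sub>L Q o\<^sub>L adj A)"
  using pos_op_conjugate[OF clinear_op_adj[OF assms(1)] assms(2)] by (simp add: adj_adj[OF assms(1)])

lemma mixed_schwarz_product:
  fixes A B T :: "'a::chilbert_space \<Rightarrow>\<^sub>L 'a"
  assumes A: "clinear_op A" and B: "clinear_op B" and T: "clinear_op T"
    and a: "0 \<le> a" "a \<le> 1"
  shows "(cmod (cinner ((A o\<^sub>L T o\<^sub>L B) x) y))\<^sup>2
    \<le> Re (cinner ((adj B o\<^sub>L op_powr (abs_op T) (2 * a) o\<^sub>L B) x) x)
      * Re (cinner ((A o\<^sub>L op_powr (abs_op (adj T)) (2 * (1 - a)) o\<^sub>L adj A) y) y)"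
  using mixed_schwarz_op_powr[OF T a, of "B x" "adj A y"]
  by (simp add: cinner_adj[OF A] cinner_adj_left[OF B])

text \<open>The vector \<open>w = y - q x\<close> is orthogonal to \<open>x\<close> and has norm \<open>sqrt (1 - q\<^sup>2)\<close>; expand the form
  at \<open>y = q x + w\<close>.\<close>

lemma quadratic_form_displacement:
  fixes Q :: "'a::complex_inner \<Rightarrow>\<^sub>L 'a"
  assumes Q: "selfadj Q" and x: "norm x = 1" and y: "norm y = 1"
    and xy: "cinner x y = complex_of_real q" and q: "0 \<le> q" "q \<le> 1"
  defines "s \<equiv> sqrt (1 - q\<^sup>2)"
  shows "Re (cinner (Q y) y) \<le> q\<^sup>2 * Re (cinner (Q x) x) + 2 * q * s * norm Q + s\<^sup>2 * norm Q"
proof -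
  define w where "w = y - q *\<^sub>R x"
  have yw: "y = q *\<^sub>R x + w" by (simp add: w_def)
  have q2: "q\<^sup>2 \<le> 1" using q by (simp add: power_le_one)
  have "(norm w)\<^sup>2 = (norm y)\<^sup>2 + 2 * Re (cinner y ((- q) *\<^sub>R x)) + (norm ((- q) *\<^sub>R x))\<^sup>2"
    using norm_add_sq[of y "(- q) *\<^sub>R x"] by (simp add: w_def)
  also have "Re (cinner y ((- q) *\<^sub>R x)) = - q * Re (cinner x y)"
    by (simp only: cinner_scaleR_right Re_cinner_commute[of x y]) simp
  finally have "(norm w)\<^sup>2 = 1 - q\<^sup>2"
    by (simp add: x y xy power2_eq_square)
  then have w: "norm w = s"
    unfolding s_def by (metis norm_ge_zero real_sqrt_unique)
  have "Re (cinner (Q w) x) = Re (cinner (Q x) w)"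
    by (simp add: selfadjD[OF Q, of w x] Re_cinner_commute)
  then have "Re (cinner (Q y) y)
      = q\<^sup>2 * Re (cinner (Q x) x) + 2 * q * Re (cinner (Q x) w) + Re (cinner (Q w) w)"
    unfolding yw
    by (simp add: blinfun.bilinear_simps cinner_add_left cinner_add_right cinner_scaleR_left
        cinner_scaleR_right power2_eq_square algebra_simps)
  also have "\<dots> \<le> q\<^sup>2 * Re (cinner (Q x) x) + 2 * q * (norm Q * s) + norm Q * s * s"
    using quadratic_form_le_norm[of Q x w] quadratic_form_le_norm[of Q w w] q x w
    by (intro add_mono mult_left_mono) auto
  finally show ?thesis by (simp add: power2_eq_square mult_ac)
qed

text \<open>After the displacement estimate the product of the forms is a sum of three terms. Roots are
  subadditive, and the arithmetic-geometric mean inequality turns the first root into the average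
  of the forms at \<open>x\<close>.\<close>

lemma product_form_bound:
  fixes P Q :: "'a::chilbert_space \<Rightarrow>\<^sub>L 'a"
  assumes P: "pos_op P" and Q: "pos_op Q"
    and c: "c\<^sup>2 \<le> Re (cinner (P x) x) * Re (cinner (Q y) y)"
    and x: "norm x = 1" and y: "norm y = 1"
    and xy: "cinner x y = complex_of_real q" and q: "0 \<le> q" "q \<le> 1"
  defines "s \<equiv> sqrt (1 - q\<^sup>2)"
  shows "c \<le> q / 2 * (Re (cinner (P x) x) + Re (cinner (Q x) x))
    + (s + sqrt (2 * q * s)) * sqrt (norm P * norm Q)"
proof -
  define p where "p = Re (cinner (P x) x)"
  define a where "a = Re (cinner (Q x) x)"
  have p: "0 \<le> p" "p \<le> norm P"
    using P quadratic_form_le_norm[of P x x] by (simp_all add: p_def pos_op_def x)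
  have a: "0 \<le> a" using Q by (simp add: a_def pos_op_def)
  have s: "0 \<le> s" unfolding s_def using q by (simp add: power_le_one)
  have pn: "p * norm Q \<le> norm P * norm Q" using p by (simp add: mult_right_mono)
  have qy: "Re (cinner (Q y) y) \<le> q\<^sup>2 * a + 2 * q * s * norm Q + s\<^sup>2 * norm Q"
    unfolding a_def s_def
    by (rule quadratic_form_displacement[OF pos_op_selfadj[OF Q] x y xy q])
  have "c\<^sup>2 \<le> p * Re (cinner (Q y) y)" using c by (simp add: p_def)
  also have "\<dots> \<le> p * (q\<^sup>2 * a + 2 * q * s * norm Q + s\<^sup>2 * norm Q)"
    by (rule mult_left_mono[OF qy p(1)])
  also have "\<dots> = q\<^sup>2 * (p * a) + 2 * q * s * (p * norm Q) + s\<^sup>2 * (p * norm Q)"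
    by (simp add: algebra_simps)
  also have "\<dots> \<le> q\<^sup>2 * (p * a) + 2 * q * s * (norm P * norm Q) + s\<^sup>2 * (norm P * norm Q)"
    using q s p a by (intro add_mono mult_left_mono pn) auto
  finally have "c \<le> sqrt (q\<^sup>2 * (p * a) + 2 * q * s * (norm P * norm Q) + s\<^sup>2 * (norm P * norm Q))"
    by (rule real_le_rsqrt)
  also have "\<dots> \<le> sqrt (q\<^sup>2 * (p * a) + 2 * q * s * (norm P * norm Q)) + sqrt (s\<^sup>2 * (norm P * norm Q))"
    using q s p a by (intro sqrt_add_le_add_sqrt) auto
  also have "\<dots> \<le> sqrt (q\<^sup>2 * (p * a)) + sqrt (2 * q * s * (norm P * norm Q))
      + sqrt (s\<^sup>2 * (norm P * norm Q))"
    using q s p a by (intro add_right_mono sqrt_add_le_add_sqrt) auto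
  also have "\<dots> = q * sqrt (p * a) + (s + sqrt (2 * q * s)) * sqrt (norm P * norm Q)"
    using q s by (simp add: real_sqrt_mult algebra_simps)
  also have "q * sqrt (p * a) \<le> q * ((p + a) / 2)"
    using q p a by (intro mult_left_mono arith_geo_mean_sqrt) auto
  finally show ?thesis by (simp add: p_def a_def)
qed

lemma q_numerical_radius_le:
  fixes T :: "'a::complex_inner \<Rightarrow>\<^sub>L 'a"
  assumes "0 \<le> K"
    and "\<And>x y. norm x = 1 \<Longrightarrow> norm y = 1 \<Longrightarrow> cinner x y = complex_of_real q
      \<Longrightarrow> cmod (cinner (T x) y) \<le> K"
  shows "q_numerical_radius q T \<le> K"
  unfolding q_numerical_radius_def Let_def
  using assms by (auto intro!: cSup_least)

theorem theorem2p16: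
  fixes A B C D S T :: "'a::chilbert_space \<Rightarrow>\<^sub>L 'a"
    and q \<alpha> :: real
  assumes "clinear_op A" and "clinear_op B" and "clinear_op C"
    and "clinear_op D" and "clinear_op S" and "clinear_op T"
    and "0 \<le> q" and "q \<le> 1"
    and "0 \<le> \<alpha>" and "\<alpha> \<le> 1"
  shows "q_numerical_radius q ((A o\<^sub>L T o\<^sub>L B) + (C o\<^sub>L S o\<^sub>L D)) \<le>
      q / 2 * norm
          ((adj B o\<^sub>L op_powr (abs_op T) (2 * \<alpha>) o\<^sub>L B)
         + (A o\<^sub>L op_powr (abs_op (adj T)) (2 * (1 - \<alpha>)) o\<^sub>L adj A)
         + (adj D o\<^sub>L op_powr (abs_op S) (2 * \<alpha>) o\<^sub>L D)
         + (C o\<^sub>L op_powr (abs_op (adj S)) (2 * (1 - \<alpha>)) o\<^sub>L adj C))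
      + (sqrt (1 - q\<^sup>2) + sqrt (2 * q * sqrt (1 - q\<^sup>2))) *
        (sqrt (norm (adj B o\<^sub>L op_powr (abs_op T) (2 * \<alpha>) o\<^sub>L B)
             * norm (A o\<^sub>L op_powr (abs_op (adj T)) (2 * (1 - \<alpha>)) o\<^sub>L adj A))
       + sqrt (norm (adj D o\<^sub>L op_powr (abs_op S) (2 * \<alpha>) o\<^sub>L D)
             * norm (C o\<^sub>L op_powr (abs_op (adj S)) (2 * (1 - \<alpha>)) o\<^sub>L adj C)))"
proof -
  define P1 where "P1 = adj B o\<^sub>L op_powr (abs_op T) (2 * \<alpha>) o\<^sub>L B"
  define Q1 where "Q1 = A o\<^sub>L op_powr (abs_op (adj T)) (2 * (1 - \<alpha>)) o\<^sub>L adj A"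
  define P2 where "P2 = adj D o\<^sub>L op_powr (abs_op S) (2 * \<alpha>) o\<^sub>L D"
  define Q2 where "Q2 = C o\<^sub>L op_powr (abs_op (adj S)) (2 * (1 - \<alpha>)) o\<^sub>L adj C"
  define s where "s = sqrt (1 - q\<^sup>2)"
  have "0 \<le> s" unfolding s_def using assms(7,8) by (simp add: power_le_one)
  then have nonneg: "0 \<le> q / 2 * norm (P1 + Q1 + P2 + Q2)
      + (s + sqrt (2 * q * s)) * (sqrt (norm P1 * norm Q1) + sqrt (norm P2 * norm Q2))"
    using assms(7) by (intro add_nonneg_nonneg mult_nonneg_nonneg) auto
  have pos: "pos_op (op_powr (abs_op F) (2 * \<alpha>))"
    "pos_op (op_powr (abs_op (adj F)) (2 * (1 - \<alpha>)))" if "clinear_op F" for F :: "'a \<Rightarrow>\<^sub>L 'a"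
    using assms(9,10) that by (auto intro!: pos_op_op_powr pos_op_abs_op clinear_op_adj)
  have "q_numerical_radius q ((A o\<^sub>L T o\<^sub>L B) + (C o\<^sub>L S o\<^sub>L D))
      \<le> q / 2 * norm (P1 + Q1 + P2 + Q2)
        + (s + sqrt (2 * q * s)) * (sqrt (norm P1 * norm Q1) + sqrt (norm P2 * norm Q2))"
  proof (rule q_numerical_radius_le[OF nonneg])
    fix x y :: 'a
    assume x: "norm x = 1" and y: "norm y = 1" and xy: "cinner x y = complex_of_real q"
    have 1: "cmod (cinner ((A o\<^sub>L T o\<^sub>L B) x) y)
        \<le> q / 2 * (Re (cinner (P1 x) x) + Re (cinner (Q1 x) x))
          + (s + sqrt (2 * q * s)) * sqrt (norm P1 * norm Q1)"
      unfolding s_def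
    proof (rule product_form_bound[OF _ _ _ x y xy assms(7,8)])
      show "pos_op P1" unfolding P1_def by (rule pos_op_conjugate[OF assms(2) pos(1)[OF assms(6)]])
      show "pos_op Q1" unfolding Q1_def by (rule pos_op_conjugate_adj[OF assms(1) pos(2)[OF assms(6)]])
      show "(cmod (cinner ((A o\<^sub>L T o\<^sub>L B) x) y))\<^sup>2 \<le> Re (cinner (P1 x) x) * Re (cinner (Q1 y) y)"
        unfolding P1_def Q1_def
        by (rule mixed_schwarz_product[OF assms(1) assms(2) assms(6) assms(9) assms(10)])
    qed
    have 2: "cmod (cinner ((C o\<^sub>L S o\<^sub>L D) x) y)
        \<le> q / 2 * (Re (cinner (P2 x) x) + Re (cinner (Q2 x) x))
          + (s + sqrt (2 * q * s)) * sqrt (norm P2 * norm Q2)"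
      unfolding s_def
    proof (rule product_form_bound[OF _ _ _ x y xy assms(7,8)])
      show "pos_op P2" unfolding P2_def by (rule pos_op_conjugate[OF assms(4) pos(1)[OF assms(5)]])
      show "pos_op Q2" unfolding Q2_def by (rule pos_op_conjugate_adj[OF assms(3) pos(2)[OF assms(5)]])
      show "(cmod (cinner ((C o\<^sub>L S o\<^sub>L D) x) y))\<^sup>2 \<le> Re (cinner (P2 x) x) * Re (cinner (Q2 y) y)"
        unfolding P2_def Q2_def
        by (rule mixed_schwarz_product[OF assms(3) assms(4) assms(5) assms(9) assms(10)])
    qed
    have "cmod (cinner (((A o\<^sub>L T o\<^sub>L B) + (C o\<^sub>L S o\<^sub>L D)) x) y)
        \<le> cmod (cinner ((A o\<^sub>L T o\<^sub>L B) x) y) + cmod (cinner ((C o\<^sub>L S o\<^sub>L D) x) y)"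
      unfolding blinfun.add_left cinner_add_left by (rule norm_triangle_ineq)
    also have "\<dots> \<le> q / 2 * Re (cinner ((P1 + Q1 + P2 + Q2) x) x)
        + (s + sqrt (2 * q * s)) * (sqrt (norm P1 * norm Q1) + sqrt (norm P2 * norm Q2))"
      using add_mono[OF 1 2] by (simp add: blinfun.add_left cinner_add_left algebra_simps)
    also have "\<dots> \<le> q / 2 * norm (P1 + Q1 + P2 + Q2)
        + (s + sqrt (2 * q * s)) * (sqrt (norm P1 * norm Q1) + sqrt (norm P2 * norm Q2))"
      using quadratic_form_le_norm[of "P1 + Q1 + P2 + Q2" x x] x assms(7)
      by (intro add_right_mono mult_left_mono) auto
    finally show "cmod (cinner (((A o\<^sub>L T o\<^sub>L B) + (C o\<^sub>L S o\<^sub>L D)) x) y)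
        \<le> q / 2 * norm (P1 + Q1 + P2 + Q2)
          + (s + sqrt (2 * q * s)) * (sqrt (norm P1 * norm Q1) + sqrt (norm P2 * norm Q2))" .
  qed
  then show ?thesis
    unfolding P1_def Q1_def P2_def Q2_def s_def .
qed

end
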